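(* Let $\pi$ be a set of primes and let $G$ be a finite $\pi$-separable group. Then $\operatorname{Irr}_{\mathcal{P}_{\pi}}(G)=\operatorname{Irr}_{\mathcal{P}}(G)$ if and only if $G$ is a $\pi$-group.
   Context: All groups are finite and all characters are complex characters. $\operatorname{Irr}(G)$ is the set of irreducible characters of $G$. For a set $\pi$ of primes, $\pi'$ is the complementary set of primes; a positive integer is a $\pi$-number if all of its prime divisors lie in $\pi$ (so $1$ is a $\pi$-number), and a $\pi$-group ($\pi'$-group) is a finite group whose order is a $\pi$-number ($\pi'$-number). A finite group is $\pi$-separable if each of its chief factors is either a $\pi$-group or a $\pi'$-group. For a subgroup $M\le G$, $1_M$ is the principal (trivial) character of $M$ and $(1_M)^G$ is the character of $G$ induced from it; $[\cdot,\cdot]$ is the usual inner product of class functions. A character $\chi\in\operatorname{Irr}(G)$ is a $\mathcal{P}$-character of $G$ if $[\chi,(1_M)^G]\neq 0$ for some maximal subgroup $M$ of $G$, and it is a $\mathcal{P}_\pi$-character of $G$ if $[\chi,(1_M)^G]\neq 0$ for some maximal subgroup $M$ of $G$ such that $|G:M|$ is a $\pi$-number. $\operatorname{Irr}_{\mathcal{P}}(G)$ and $\operatorname{Irr}_{\mathcal{P}_\pi}(G)$ denote the sets of all $\mathcal{P}$-characters and of all $\mathcal{P}_\pi$-characters of $G$, respectively. *)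

theory Defs
  imports
    "HOL-Algebra.Algebra"
    "HOL-Computational_Algebra.Primes"
    "Jordan_Normal_Form.VS_Connect"
begin

definition prime_compl :: "nat set \<Rightarrow> nat set" where
  "prime_compl \<pi> = {p. Factorial_Ring.prime p \<and> p \<notin> \<pi>}"

definition pi_number :: "nat set \<Rightarrow> nat \<Rightarrow> bool" where
  "pi_number \<pi> n \<longleftrightarrow> n > 0 \<and> (\<forall>p. Factorial_Ring.prime p \<longrightarrow> p dvd n \<longrightarrow> p \<in> \<pi>)"

definition pi_group :: "nat set \<Rightarrow> ('a, 'b) monoid_scheme \<Rightarrow> bool" where
  "pi_group \<pi> G \<longleftrightarrow> group G \<and> finite (carrier G) \<and> pi_number \<pi> (Coset.order G)"

text \<open>A chief factor of \<open>G\<close> is the quotient \<open>H / K\<close> for a pair as below; equivalently, \<open>H / K\<close> is a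
  minimal normal subgroup of \<open>G / K\<close>.\<close>

definition chief_pair :: "('a, 'b) monoid_scheme \<Rightarrow> 'a set \<Rightarrow> 'a set \<Rightarrow> bool" where
  "chief_pair G H K \<longleftrightarrow> H \<lhd> G \<and> K \<lhd> G \<and> K \<subset> H \<and>
     (\<forall>L. L \<lhd> G \<longrightarrow> K \<subseteq> L \<longrightarrow> L \<subseteq> H \<longrightarrow> L = K \<or> L = H)"

definition pi_separable :: "nat set \<Rightarrow> ('a, 'b) monoid_scheme \<Rightarrow> bool" where
  "pi_separable \<pi> G \<longleftrightarrow> group G \<and> finite (carrier G) \<and>
     (\<forall>H K. chief_pair G H K \<longrightarrow>
        pi_group \<pi> (G\<lparr>carrier := H\<rparr> Mod K) \<or>
        pi_group (prime_compl \<pi>) (G\<lparr>carrier := H\<rparr> Mod K))"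

definition maximal_subgroup :: "'a set \<Rightarrow> ('a, 'b) monoid_scheme \<Rightarrow> bool" where
  "maximal_subgroup M G \<longleftrightarrow> subgroup M G \<and> M \<noteq> carrier G \<and>
     (\<forall>H. subgroup H G \<longrightarrow> M \<subseteq> H \<longrightarrow> H = M \<or> H = carrier G)"

definition subgroup_index :: "('a, 'b) monoid_scheme \<Rightarrow> 'a set \<Rightarrow> nat" where
  "subgroup_index G M = card (rcosets\<^bsub>G\<^esub> M)"

definition general_linear :: "nat \<Rightarrow> complex mat monoid" where
  "general_linear n = units_of (ring_mat TYPE(complex) n ())"

definition mat_trace :: "complex mat \<Rightarrow> complex" where
  "mat_trace A = sum_list (diag_mat A)"

definition matrix_rep ::
  "('a, 'b) monoid_scheme \<Rightarrow> nat \<Rightarrow> ('a \<Rightarrow> complex mat) \<Rightarrow> bool" where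
  "matrix_rep G n \<rho> \<longleftrightarrow> \<rho> \<in> hom G (general_linear n)"

definition irreducible_rep ::
  "('a, 'b) monoid_scheme \<Rightarrow> nat \<Rightarrow> ('a \<Rightarrow> complex mat) \<Rightarrow> bool" where
  "irreducible_rep G n \<rho> \<longleftrightarrow> matrix_rep G n \<rho> \<and> n > 0 \<and>
     (\<forall>W. subspace class_ring W (module_vec TYPE(complex) n) \<longrightarrow>
          (\<forall>g\<in>carrier G. \<forall>w\<in>W. \<rho> g *\<^sub>v w \<in> W) \<longrightarrow>
          W = {0\<^sub>v n} \<or> W = carrier_vec n)"

text \<open>Complex-valued functions on a group are extensional, i.e. \<open>undefined\<close> off the carrier, so that
  equality of characters is equality on the group.\<close>

definition rep_character ::
  "('a, 'b) monoid_scheme \<Rightarrow> ('a \<Rightarrow> complex mat) \<Rightarrow> 'a \<Rightarrow> complex" where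
  "rep_character G \<rho> = (\<lambda>g\<in>carrier G. mat_trace (\<rho> g))"

definition Irr :: "('a, 'b) monoid_scheme \<Rightarrow> ('a \<Rightarrow> complex) set" where
  "Irr G = {rep_character G \<rho> | n \<rho>. irreducible_rep G n \<rho>}"

definition char_inner ::
  "('a, 'b) monoid_scheme \<Rightarrow> ('a \<Rightarrow> complex) \<Rightarrow> ('a \<Rightarrow> complex) \<Rightarrow> complex" where
  "char_inner G \<phi> \<psi> = (\<Sum>g\<in>carrier G. \<phi> g * cnj (\<psi> g)) / of_nat (Coset.order G)"

definition principal_char :: "'a set \<Rightarrow> 'a \<Rightarrow> complex" where
  "principal_char M = (\<lambda>g\<in>M. 1)"

definition induced_char ::
  "('a, 'b) monoid_scheme \<Rightarrow> 'a set \<Rightarrow> ('a \<Rightarrow> complex) \<Rightarrow> 'a \<Rightarrow> complex" where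
  "induced_char G M \<phi> = (\<lambda>g\<in>carrier G.
     (\<Sum>x\<in>carrier G.
        if x \<otimes>\<^bsub>G\<^esub> g \<otimes>\<^bsub>G\<^esub> inv\<^bsub>G\<^esub> x \<in> M then \<phi> (x \<otimes>\<^bsub>G\<^esub> g \<otimes>\<^bsub>G\<^esub> inv\<^bsub>G\<^esub> x) else 0)
     / of_nat (card M))"

definition Irr_P :: "('a, 'b) monoid_scheme \<Rightarrow> ('a \<Rightarrow> complex) set" where
  "Irr_P G = {\<chi> \<in> Irr G. \<exists>M. maximal_subgroup M G \<and>
     char_inner G \<chi> (induced_char G M (principal_char M)) \<noteq> 0}"

definition Irr_P_pi :: "nat set \<Rightarrow> ('a, 'b) monoid_scheme \<Rightarrow> ('a \<Rightarrow> complex) set" where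
  "Irr_P_pi \<pi> G = {\<chi> \<in> Irr G. \<exists>M. maximal_subgroup M G \<and>
     pi_number \<pi> (subgroup_index G M) \<and>
     char_inner G \<chi> (induced_char G M (principal_char M)) \<noteq> 0}"

end

theory Submission
  imports Defs "Jordan_Normal_Form.DL_Rank"
begin

text \<open>
  Indices in a \<open>\<pi>\<close>-group are \<open>\<pi>\<close>-numbers, so only one direction needs work. If \<open>G\<close> is not a
  \<open>\<pi>\<close>-group, take the least normal subgroup \<open>K\<close> of \<open>\<pi>\<close>-index and a chief factor \<open>K / N\<close>, which must
  be a \<open>\<pi>'\<close>-group. A minimal normal subgroup of coprime index has a proper supplement: the normalizer
  of one of its Sylow subgroups or, if that is everything, a complement to an abelian normal subgroup.
  Hence there is a maximal subgroup \<open>M\<close> with \<open>N \<subseteq> M\<close> and \<open>M K = G\<close>.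

  By Frobenius reciprocity \<open>[\<chi>, (1\<^sub>M)\<^sup>G]\<close> is the mean of \<open>\<chi>\<close> over \<open>M\<close>. The difference of the means over
  \<open>M\<close> and over \<open>G\<close> is nonzero for the regular representation and additive along invariant subspaces,
  so it is nonzero for some irreducible \<open>\<chi>\<close>; this \<open>\<chi>\<close> is nontrivial and lies over \<open>1\<^sub>M\<close>. Suppose \<open>\<chi>\<close>
  also lies over \<open>1\<^sub>L\<close> for a maximal subgroup \<open>L\<close> of \<open>\<pi>\<close>-index. If \<open>N \<subseteq> L\<close>, then \<open>K \<subseteq> L\<close> because
  \<open>|K : N|\<close> is a \<open>\<pi>'\<close>-number, so \<open>K\<close> acts trivially and the vector fixed by \<open>M\<close> is fixed by \<open>M K = G\<close>.
  Otherwise \<open>N L = G\<close>, and as \<open>N\<close> acts trivially the vector fixed by \<open>L\<close> is fixed by \<open>G\<close>. Either way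
  \<open>\<chi>\<close> is trivial, a contradiction.
\<close>

section \<open>Matrix representations\<close>

text \<open>A maximal independent subset of \<open>W\<close> spans \<open>W\<close>, and it extends
  to a basis of the whole space. The columns of \<open>P\<close> list this basis with the
  \<open>k\<close> vectors from \<open>W\<close> first; \<open>Q\<close> is the inverse of
  \<open>P\<close> and reads off coordinates, so vectors of \<open>W\<close> have coordinate 0 from
  position \<open>k\<close> on. This brings a reducible representation to block triangular
  form.\<close>

lemma subspace_adapted_basis:
  fixes W :: "complex vec set"
  assumes W: "subspace class_ring W (module_vec TYPE(complex) n)"
    and nontriv: "W \<noteq> {0\<^sub>v n}" "W \<noteq> carrier_vec n"
  obtains k P Q where "0 < k" "k < n" "P \<in> carrier_mat n n" "Q \<in> carrier_mat n n"
    "P * Q = 1\<^sub>m n" "Q * P = 1\<^sub>m n" "\<And>j. j < k \<Longrightarrow> col P j \<in> W"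
    "\<And>w i. w \<in> W \<Longrightarrow> k \<le> i \<Longrightarrow> i < n \<Longrightarrow> (Q *\<^sub>v w) $ i = 0"
proof -
  interpret vec_space "TYPE(complex)" n .
  have Wsub: "submodule class_ring W V" using W by (rule is_module)
  have WV: "W \<subseteq> carrier_vec n"
    using submodule.subset[OF Wsub] by simp
  let ?li = "\<lambda>U T. T \<subseteq> U \<and> lin_indpt T"
  have bound: "finite T \<and> card T \<le> n" if "?li U T" "U \<subseteq> carrier_vec n" for U T
    using li_le_dim[of T] that dim_is_n by auto
  have indpt_empty: "lin_indpt {}" by (auto simp: lin_dep_def)
  obtain B1 where B1: "finite B1" "maximal B1 (?li W)"
    using maximal_exists[of "?li W" n "{}"] bound[OF _ WV] indpt_empty by auto
  have B1W: "B1 \<subseteq> W" and B1li: "lin_indpt B1" using B1(2) by (auto simp: maximal_def)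
  \<comment> \<open>A set maximal among the independent sets containing \<open>B1\<close> is maximal
    among all independent sets, hence a basis of the whole space.\<close>
  define ext where "ext = (\<lambda>T. B1 \<subseteq> T \<and> ?li (carrier_vec n) T)"
  have "finite T \<and> card T \<le> n" if "ext T" for T
    using bound[of T "carrier_vec n"] that by (simp add: ext_def)
  moreover have "ext B1" using B1W B1li WV by (simp add: ext_def)
  ultimately obtain B where B: "finite B" "maximal B ext"
    using maximal_exists[of ext n B1] by blast
  have BC: "B \<subseteq> carrier_vec n" and Bli: "lin_indpt B" and BB: "B1 \<subseteq> B"
    using B(2) by (auto simp: maximal_def ext_def)
  have "T = B" if "T \<supseteq> B" "T \<subseteq> carrier_vec n" "lin_indpt T" for T
  proof -
    have "ext T" using that BB by (simp add: ext_def)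
    with B(2) that(1) show ?thesis unfolding maximal_def by blast
  qed
  then have "maximal B (\<lambda>T. T \<subseteq> carrier_vec n \<and> lin_indpt T)"
    unfolding maximal_def using BC Bli by simp
  then have "basis B" by (rule max_li_is_basis)
  then have cardB: "card B = n" using dim_basis[OF B(1)] dim_is_n by simp
  have W_span: "w \<in> span B1" if "w \<in> W" for w
  proof (cases "w \<in> B1")
    case True
    then show ?thesis using in_own_span[of B1] B1W WV by auto
  next
    case False
    \<comment> \<open>By maximality of \<open>B1\<close> inside \<open>W\<close>, adjoining a
      further vector of \<open>W\<close> creates a dependence; as \<open>B1\<close> itself is
      independent, \<open>w\<close> lies in its span.\<close>
    have "lin_dep (B1 \<union> {w})"
    proof (rule ccontr)
      assume "lin_indpt (B1 \<union> {w})"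
      then have "B1 \<union> {w} = B1" using B1(2) that B1W unfolding maximal_def by blast
      then show False using False by auto
    qed
    moreover have "B1 \<subseteq> carrier_vec n" "w \<in> carrier_vec n" using B1W WV that by auto
    ultimately show ?thesis
      using lin_dep_iff_in_span[of B1 w] B1li False by blast
  qed
  obtain xs where xs: "set xs = B1" "distinct xs" using finite_distinct_list[OF B1(1)] by blast
  obtain ys where ys: "set ys = B - B1" "distinct ys" using finite_distinct_list[of "B - B1"] B(1) by auto
  define P where "P = mat_of_cols n (xs @ ys)"
  define k where "k = length xs"
  have set_xy: "set (xs @ ys) = B" using xs ys BB by auto
  have len: "length (xs @ ys) = n"
    using distinct_card[of "xs @ ys"] xs ys cardB set_xy by auto
  have P: "P \<in> carrier_mat n n" unfolding P_def mat_of_cols_def len by simp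
  have cols: "cols P = xs @ ys" unfolding P_def using set_xy BC by (intro cols_mat_of_cols) auto
  have dist: "distinct (cols P)" using cols xs ys by auto
  have "rank P = n" using lin_indpt_full_rank[OF P dist] cols set_xy Bli by simp
  then have "det P \<noteq> 0" using det_rank_iff[OF P] by simp
  then obtain Q where Q: "Q \<in> carrier_mat n n" "Q * P = 1\<^sub>m n" "P * Q = 1\<^sub>m n"
    using det_non_zero_imp_unit[OF P, of "()"] unfolding Units_def
    by (auto simp: ring_mat_def)
  have colP: "col P j = (xs @ ys) ! j" if "j < n" for j
    using that cols P by (metis cols_nth carrier_matD(2))
  have colW: "col P j \<in> W" if "j < k" for j
  proof -
    have "j < n" using that len k_def by auto
    then have "col P j = xs ! j" using colP that by (simp add: nth_append k_def)
    then show ?thesis using that xs B1W by (auto simp: k_def)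
  qed
  have QW: "(Q *\<^sub>v w) $ i = 0" if w: "w \<in> W" and i: "k \<le> i" "i < n" for w i
  proof -
    obtain a where a: "lincomb a B1 = w"
      using finite_in_span[OF B1(1), of w] W_span[OF w] B1W WV by auto
    \<comment> \<open>Extending the coefficients of \<open>w\<close> by 0 to all of \<open>B\<close>
      gives the coordinate vector \<open>c\<close> with \<open>P *\<^sub>v c = w\<close>; its
      entries at the columns from \<open>ys\<close> are 0.\<close>
    define b where "b = (\<lambda>v. if v \<in> B1 then a v else 0)"
    define c where "c = vec n (\<lambda>i. b (col P i))"
    have "P *\<^sub>v c = lincomb b (set (cols P))"
      unfolding c_def by (rule mat_mult_eq_lincomb[OF P dist])
    also have "set (cols P) = B1 \<union> (B - B1)" using cols set_xy BB by auto
    also have "lincomb b (B1 \<union> (B - B1)) = lincomb b B1"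
      using B1 B BC BB by (intro lincomb_clean) (auto simp: b_def)
    also have "\<dots> = lincomb a B1"
      using B1W WV by (intro lincomb_cong) (auto simp: b_def)
    finally have Pc: "P *\<^sub>v c = w" using a by simp
    have "c \<in> carrier_vec n" by (simp add: c_def)
    then have "Q *\<^sub>v w = c"
      using Pc Q P by (metis assoc_mult_mat_vec one_mult_mat_vec)
    moreover have "c $ i = 0"
    proof -
      have "col P i = ys ! (i - k)" using colP i by (simp add: nth_append k_def)
      moreover have "ys ! (i - k) \<in> set ys" using i len by (intro nth_mem) (auto simp: k_def)
      ultimately show ?thesis using ys i by (auto simp: c_def b_def)
    qed
    ultimately show ?thesis by simp
  qed
  have "k \<noteq> 0"
  proof
    assume "k = 0"
    then have "B1 = {}" using xs by (auto simp: k_def)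
    then have "W \<subseteq> {0\<^sub>v n}" using W_span span_empty by auto
    moreover have "0\<^sub>v n \<in> W" using submodule.zero_closed[OF Wsub] by simp
    ultimately show False using nontriv by blast
  qed
  moreover have "k \<noteq> n"
  proof
    assume "k = n"
    then have "ys = []" using len by (auto simp: k_def)
    then have "B1 = B" using ys BB by auto
    then have "carrier_vec n \<subseteq> span B1" using \<open>basis B\<close> by (auto simp: basis_def)
    moreover have "span B1 \<subseteq> W" using span_is_subset[OF B1W Wsub] .
    ultimately show False using nontriv WV by blast
  qed
  moreover have "k \<le> n" using len by (simp add: k_def)
  ultimately show thesis using that[OF _ _ P Q(1) Q(3) Q(2) colW QW] by simp
qed

section \<open>Traces and matrix representations in coordinates\<close>

lemma mat_trace_sum: "A \<in> carrier_mat n n \<Longrightarrow> mat_trace A = (\<Sum>i<n. A $$ (i,i))"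
  by (simp add: mat_trace_def diag_mat_def sum_list_sum_nth lessThan_atLeast0)

lemma mat_trace_comm:
  assumes "A \<in> carrier_mat n n" "B \<in> carrier_mat n n"
  shows "mat_trace (A * B) = mat_trace (B * A)"
proof -
  have "mat_trace (A * B) = (\<Sum>i<n. \<Sum>j<n. A $$ (i,j) * B $$ (j,i))"
    using assms by (subst mat_trace_sum[of _ n]) (auto simp: scalar_prod_def lessThan_atLeast0)
  also have "\<dots> = (\<Sum>j<n. \<Sum>i<n. B $$ (j,i) * A $$ (i,j))"
    by (subst sum.swap) (simp add: mult.commute)
  also have "\<dots> = mat_trace (B * A)"
    using assms by (subst mat_trace_sum[of _ n]) (auto simp: scalar_prod_def lessThan_atLeast0)
  finally show ?thesis .
qed

lemma sum_lessThan_split: "(\<Sum>i<l + k. f i) = (\<Sum>i<k. f i) + (\<Sum>i<l. f (k + i))" for f :: "nat \<Rightarrow> 'a::comm_monoid_add"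
  by (induction l) (auto simp: ac_simps)

lemma mat_trace_four_block:
  assumes "A \<in> carrier_mat k k" "D \<in> carrier_mat l l"
  shows "mat_trace (four_block_mat A B C D) = mat_trace A + mat_trace D"
proof -
  have "mat_trace (four_block_mat A B C D) = (\<Sum>i<k+l. four_block_mat A B C D $$ (i,i))"
    using assms by (intro mat_trace_sum) auto
  also have "\<dots> = (\<Sum>i<k. A $$ (i,i)) + (\<Sum>i<l. D $$ (i,i))"
    using assms by (simp add: sum.nat_group[symmetric] add.commute[of k l] sum_lessThan_split)
  finally show ?thesis using assms by (simp add: mat_trace_sum)
qed

text \<open>Invertibility of each matrix is automatic: \<open>\<rho> (inv g)\<close> inverts
  \<open>\<rho> g\<close> once \<open>\<rho>\<close> is multiplicative and sends the identity to the
  identity matrix. Conversely, a homomorphism into the unit group preserves the identity.\<close>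

lemma (in group) matrix_rep_iff:
  "matrix_rep G n \<rho> \<longleftrightarrow> (\<forall>g\<in>carrier G. \<rho> g \<in> carrier_mat n n) \<and> \<rho> \<one> = 1\<^sub>m n \<and>
     (\<forall>g\<in>carrier G. \<forall>h\<in>carrier G. \<rho> (g \<otimes> h) = \<rho> g * \<rho> h)"
proof -
  interpret M: ring "ring_mat TYPE(complex) n ()" by (rule ring_mat)
  have simps: "carrier (ring_mat TYPE(complex) n ()) = carrier_mat n n"
    "monoid.mult (ring_mat TYPE(complex) n ()) = (*)" "monoid.one (ring_mat TYPE(complex) n ()) = 1\<^sub>m n"
    by (simp_all add: ring_mat_simps)
  show ?thesis
  proof
    assume r: "matrix_rep G n \<rho>"
    have "group (units_of (ring_mat TYPE(complex) n ()))" by (rule M.units_group)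
    then have "\<rho> \<one> = \<one>\<^bsub>units_of (ring_mat TYPE(complex) n ())\<^esub>"
      using r hom_one[of \<rho> G "units_of (ring_mat TYPE(complex) n ())"] is_group
      by (simp add: matrix_rep_def general_linear_def)
    then show "(\<forall>g\<in>carrier G. \<rho> g \<in> carrier_mat n n) \<and> \<rho> \<one> = 1\<^sub>m n \<and>
      (\<forall>g\<in>carrier G. \<forall>h\<in>carrier G. \<rho> (g \<otimes> h) = \<rho> g * \<rho> h)"
      using r by (auto simp: matrix_rep_def general_linear_def hom_def units_of_def simps
          Units_def Pi_def)
  next
    assume r: "(\<forall>g\<in>carrier G. \<rho> g \<in> carrier_mat n n) \<and> \<rho> \<one> = 1\<^sub>m n \<and>
      (\<forall>g\<in>carrier G. \<forall>h\<in>carrier G. \<rho> (g \<otimes> h) = \<rho> g * \<rho> h)"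
    have "\<rho> g \<in> Units (ring_mat TYPE(complex) n ())" if "g \<in> carrier G" for g
      unfolding Units_def simps
      using r that by (auto intro!: bexI[of _ "\<rho> (inv g)"]) (metis inv_closed l_inv r_inv)+
    then show "matrix_rep G n \<rho>"
      using r by (auto simp: matrix_rep_def general_linear_def hom_def units_of_def simps)
  qed
qed

section \<open>Means of characters over subgroups and fixed vectors\<close>

text \<open>For a representation \<open>\<rho>\<close> and a finite subgroup \<open>M\<close> this
  is the multiplicity of the principal character in the restriction to \<open>M\<close> of the
  character of \<open>\<rho>\<close>.\<close>

definition mean_trace :: "'a set \<Rightarrow> ('a \<Rightarrow> complex mat) \<Rightarrow> complex" where
  "mean_trace M \<rho> = (\<Sum>g\<in>M. mat_trace (\<rho> g)) / of_nat (card M)"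

context group
begin

lemma matrix_rep_mult_vec:
  assumes "matrix_rep G n \<rho>" "g \<in> carrier G" "h \<in> carrier G" "v \<in> carrier_vec n"
  shows "\<rho> (g \<otimes> h) *\<^sub>v v = \<rho> g *\<^sub>v (\<rho> h *\<^sub>v v)"
  using assms by (metis matrix_rep_iff assoc_mult_mat_vec)

text \<open>In a basis adapted to \<open>W\<close> every matrix is block upper triangular. The
  diagonal blocks \<open>A\<close> (the action on \<open>W\<close>) and \<open>D\<close> (the action
  on the quotient by \<open>W\<close>) are multiplicative, and the trace sees only these two
  blocks.\<close>

lemma matrix_rep_reducible_split:
  assumes rep: "matrix_rep G n \<rho>"
    and W: "subspace class_ring W (module_vec TYPE(complex) n)"
    and inv: "\<forall>g\<in>carrier G. \<forall>w\<in>W. \<rho> g *\<^sub>v w \<in> W"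
    and nontriv: "W \<noteq> {0\<^sub>v n}" "W \<noteq> carrier_vec n"
  obtains k l A D where "k < n" "l < n" "matrix_rep G k A" "matrix_rep G l D"
    "\<And>g. g \<in> carrier G \<Longrightarrow> mat_trace (\<rho> g) = mat_trace (A g) + mat_trace (D g)"
proof -
  obtain k P Q where k: "0 < k" "k < n" and P: "P \<in> carrier_mat n n" and Q: "Q \<in> carrier_mat n n"
    and PQ: "P * Q = 1\<^sub>m n" and QP: "Q * P = 1\<^sub>m n" and colW: "\<And>j. j < k \<Longrightarrow> col P j \<in> W"
    and QW: "\<And>w i. w \<in> W \<Longrightarrow> k \<le> i \<Longrightarrow> i < n \<Longrightarrow> (Q *\<^sub>v w) $ i = 0"
    using subspace_adapted_basis[OF W nontriv] by metis
  define l where "l = n - k"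
  have nkl: "n = l + k" and l: "l < n" using k by (auto simp: l_def)
  have R: "\<rho> g \<in> carrier_mat n n" if "g \<in> carrier G" for g using rep that by (simp add: matrix_rep_iff)
  define S where "S g = Q * (\<rho> g * P)" for g
  have S: "S g \<in> carrier_mat n n" if "g \<in> carrier G" for g using R[OF that] P Q by (simp add: S_def)
  have S_one: "S \<one> = 1\<^sub>m n" using rep P QP by (simp add: S_def matrix_rep_iff)
  have S_mult: "S (g \<otimes> h) = S g * S h" if "g \<in> carrier G" "h \<in> carrier G" for g h
  proof -
    note R = R[OF that(1)] R[OF that(2)]
    have "S g * S h = Q * (\<rho> g * (P * (Q * (\<rho> h * P))))"
      unfolding S_def using R P Q by (simp add: assoc_mult_mat[of _ n n _ n _ n])
    also have "P * (Q * (\<rho> h * P)) = \<rho> h * P"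
      using assoc_mult_mat[of P n n Q n "\<rho> h * P" n] R P Q PQ by simp
    also have "Q * (\<rho> g * (\<rho> h * P)) = S (g \<otimes> h)"
      unfolding S_def using rep that R P Q
      by (simp add: matrix_rep_iff assoc_mult_mat[of _ n n _ n _ n])
    finally show ?thesis by simp
  qed
  \<comment> \<open>The lower left block vanishes: the first \<open>k\<close> columns of
    \<open>P\<close> lie in the invariant space \<open>W\<close>, and \<open>Q\<close> kills the
    later coordinates of vectors of \<open>W\<close>.\<close>
  have S_zero: "S g $$ (i,j) = 0" if "g \<in> carrier G" "k \<le> i" "i < n" "j < k" for g i j
  proof -
    have "S g $$ (i,j) = (Q *\<^sub>v (\<rho> g *\<^sub>v col P j)) $ i"
      using that R[OF that(1)] P Q k by (simp add: S_def mult_mat_vec_def)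
    also have "\<dots> = 0" using that inv colW by (intro QW) auto
    finally show ?thesis .
  qed
  have S_mult_index: "S (g \<otimes> h) $$ (i,j) =
      (\<Sum>m<k. S g $$ (i,m) * S h $$ (m,j)) + (\<Sum>m<l. S g $$ (i,k+m) * S h $$ (k+m,j))"
    if "g \<in> carrier G" "h \<in> carrier G" "i < n" "j < n" for g h i j
  proof -
    have "S (g \<otimes> h) $$ (i,j) = (\<Sum>m<n. S g $$ (i,m) * S h $$ (m,j))"
      unfolding S_mult[OF that(1,2)] using that S[OF that(1)] S[OF that(2)]
      by (simp add: scalar_prod_def lessThan_atLeast0)
    then show ?thesis by (simp add: nkl sum_lessThan_split)
  qed
  define A where "A g = mat k k (\<lambda>ij. S g $$ ij)" for g
  define D where "D g = mat l l (\<lambda>(i,j). S g $$ (k+i,k+j))" for g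
  have "matrix_rep G k A"
    unfolding matrix_rep_iff
  proof (intro conjI ballI)
    fix g h assume gh: "g \<in> carrier G" "h \<in> carrier G"
    show "A (g \<otimes> h) = A g * A h"
    proof (rule eq_matI)
      fix i j assume "i < dim_row (A g * A h)" "j < dim_col (A g * A h)"
      then have ij: "i < k" "j < k" by (auto simp: A_def)
      \<comment> \<open>The second sum of \<open>S_mult_index\<close> runs over the lower left block
        of \<open>S h\<close>, which is 0.\<close>
      have "A (g \<otimes> h) $$ (i,j) = (\<Sum>m<k. S g $$ (i,m) * S h $$ (m,j))"
        using ij gh k S_zero[OF gh(2), of "k + _" j] by (simp add: A_def S_mult_index nkl)
      then show "A (g \<otimes> h) $$ (i,j) = (A g * A h) $$ (i,j)"
        using ij by (simp add: A_def scalar_prod_def lessThan_atLeast0)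
    qed (auto simp: A_def)
  next
    show "A \<one> = 1\<^sub>m k" using k by (intro eq_matI) (auto simp: A_def S_one)
  qed (auto simp: A_def)
  moreover have "matrix_rep G l D"
    unfolding matrix_rep_iff
  proof (intro conjI ballI)
    fix g h assume gh: "g \<in> carrier G" "h \<in> carrier G"
    show "D (g \<otimes> h) = D g * D h"
    proof (rule eq_matI)
      fix i j assume "i < dim_row (D g * D h)" "j < dim_col (D g * D h)"
      then have ij: "i < l" "j < l" by (auto simp: D_def)
      \<comment> \<open>Here the first sum of \<open>S_mult_index\<close> vanishes, since it runs
        over the lower left block of \<open>S g\<close>.\<close>
      have "D (g \<otimes> h) $$ (i,j) = (\<Sum>m<l. S g $$ (k+i,k+m) * S h $$ (k+m,k+j))"
        using ij gh k S_zero[OF gh(1), of "k + i"] by (simp add: D_def S_mult_index nkl)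
      then show "D (g \<otimes> h) $$ (i,j) = (D g * D h) $$ (i,j)"
        using ij by (simp add: D_def scalar_prod_def lessThan_atLeast0)
    qed (auto simp: D_def)
  next
    show "D \<one> = 1\<^sub>m l" by (intro eq_matI) (auto simp: D_def S_one nkl)
  qed (auto simp: D_def)
  moreover have "mat_trace (\<rho> g) = mat_trace (A g) + mat_trace (D g)" if "g \<in> carrier G" for g
  proof -
    have "mat_trace (\<rho> g) = mat_trace ((P * Q) * \<rho> g)" using R[OF that] PQ by simp
    also have "\<dots> = mat_trace (P * (Q * \<rho> g))" using R[OF that] P Q by (simp add: assoc_mult_mat)
    also have "\<dots> = mat_trace ((Q * \<rho> g) * P)"
      using R[OF that] P Q by (intro mat_trace_comm[of _ n]) auto
    also have "\<dots> = mat_trace (S g)" using R[OF that] P Q by (simp add: S_def assoc_mult_mat)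
    also have "\<dots> = (\<Sum>i<k. S g $$ (i,i)) + (\<Sum>i<l. S g $$ (k+i,k+i))"
      using mat_trace_sum[OF S[OF that]] by (simp add: nkl sum_lessThan_split)
    also have "\<dots> = mat_trace (A g) + mat_trace (D g)"
      by (simp add: mat_trace_sum[of _ k] mat_trace_sum[of _ l] A_def D_def)
    finally show ?thesis .
  qed
  ultimately show thesis using that k(2) l by blast
qed

text \<open>Induction on the degree. Means are additive over the two diagonal blocks, so when
  \<open>\<rho>\<close> is reducible one of the blocks, of smaller degree, still has different
  means.\<close>

lemma exists_irreducible_mean_trace_neq:
  assumes "matrix_rep G n \<rho>" "M \<subseteq> carrier G" "N \<subseteq> carrier G"
    "mean_trace M \<rho> \<noteq> mean_trace N \<rho>"
  shows "\<exists>m \<sigma>. irreducible_rep G m \<sigma> \<and> mean_trace M \<sigma> \<noteq> mean_trace N \<sigma>"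
  using assms
proof (induction n arbitrary: \<rho> rule: less_induct)
  case (less n)
  have R: "\<rho> g \<in> carrier_mat n n" if "g \<in> carrier G" for g
    using less.prems(1) that by (simp add: matrix_rep_iff)
  show ?case
  proof (cases "irreducible_rep G n \<rho>")
    case True
    then show ?thesis using less.prems by blast
  next
    case False
    \<comment> \<open>Degree 0 is not irreducible by definition but has no invariant subspace to
      split along; there all traces are empty sums, so the means agree.\<close>
    have "n > 0"
    proof (rule ccontr)
      assume "\<not> n > 0"
      then have "mat_trace (\<rho> g) = 0" if "g \<in> carrier G" for g
        using mat_trace_sum[OF R[OF that]] by simp
      then have "mean_trace H \<rho> = 0" if "H \<subseteq> carrier G" for H
        using that by (simp add: mean_trace_def subset_iff)
      then show False using less.prems by simp
    qed
    with False less.prems(1) obtain W where W: "subspace class_ring W (module_vec TYPE(complex) n)"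
      "\<forall>g\<in>carrier G. \<forall>w\<in>W. \<rho> g *\<^sub>v w \<in> W" "W \<noteq> {0\<^sub>v n}" "W \<noteq> carrier_vec n"
      unfolding irreducible_rep_def by blast
    obtain k l A D where kl: "k < n" "l < n" and AD: "matrix_rep G k A" "matrix_rep G l D"
      and tr: "\<And>g. g \<in> carrier G \<Longrightarrow> mat_trace (\<rho> g) = mat_trace (A g) + mat_trace (D g)"
      using matrix_rep_reducible_split[OF less.prems(1) W] by metis
    have "mean_trace H \<rho> = mean_trace H A + mean_trace H D" if "H \<subseteq> carrier G" for H
    proof -
      have "(\<Sum>g\<in>H. mat_trace (\<rho> g)) = (\<Sum>g\<in>H. mat_trace (A g)) + (\<Sum>g\<in>H. mat_trace (D g))"
        unfolding sum.distrib[symmetric] using that tr by (intro sum.cong) auto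
      then show ?thesis by (simp add: mean_trace_def add_divide_distrib)
    qed
    then have "mean_trace M A \<noteq> mean_trace N A \<or> mean_trace M D \<noteq> mean_trace N D"
      using less.prems by auto
    then show ?thesis using less.IH kl AD less.prems(2,3) by blast
  qed
qed

text \<open>The regular representation has trace \<open>|G|\<close> at the identity and 0 elsewhere,
  so its mean over a subgroup \<open>H\<close> is \<open>|G| / |H|\<close>. This is 1 for
  \<open>G\<close> and larger for a proper subgroup.\<close>

lemma mean_trace_gap_regular:
  assumes "finite (carrier G)" "subgroup M G" "M \<noteq> carrier G"
  obtains n \<rho> where "matrix_rep G n \<rho>" "mean_trace M \<rho> \<noteq> mean_trace (carrier G) \<rho>"
proof -
  define N where "N = Coset.order G"
  have N: "N > 0" "card (carrier G) = N"
    using assms(1) by (auto simp: N_def Coset.order_def card_gt_0_iff)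
  obtain e where e: "bij_betw e {..<N} (carrier G)"
    using ex_bij_betw_nat_finite[OF assms(1)] N by (auto simp: lessThan_atLeast0)
  have eG: "e i \<in> carrier G" if "i < N" for i using e that by (auto simp: bij_betw_def)
  have e_inj: "e i = e j \<longleftrightarrow> i = j" if "i < N" "j < N" for i j
    using e that by (auto simp: bij_betw_def inj_on_def)
  \<comment> \<open>The permutation matrix of left multiplication by \<open>g\<close>, with rows and
    columns indexed through the enumeration \<open>e\<close> of the group.\<close>
  define \<rho> where "\<rho> g = mat N N (\<lambda>(i,j). if e i = g \<otimes> e j then 1 else 0 :: complex)" for g
  have "matrix_rep G N \<rho>"
    unfolding matrix_rep_iff
  proof (intro conjI ballI)
    show "\<rho> \<one> = 1\<^sub>m N" by (intro eq_matI) (auto simp: \<rho>_def eG e_inj)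
  next
    fix g h assume gh: "g \<in> carrier G" "h \<in> carrier G"
    show "\<rho> (g \<otimes> h) = \<rho> g * \<rho> h"
    proof (rule eq_matI)
      fix i j assume "i < dim_row (\<rho> g * \<rho> h)" "j < dim_col (\<rho> g * \<rho> h)"
      then have ij: "i < N" "j < N" by (auto simp: \<rho>_def)
      have "h \<otimes> e j \<in> e ` {..<N}" using e gh ij eG by (auto simp: bij_betw_def)
      \<comment> \<open>In the matrix product only the index \<open>m0\<close> of
        \<open>h \<otimes> e j\<close> contributes.\<close>
      then obtain m0 where m0: "m0 < N" "e m0 = h \<otimes> e j" by auto
      have "(\<rho> g * \<rho> h) $$ (i,j) =
          (\<Sum>m<N. (if e i = g \<otimes> e m then 1 else 0) * (if e m = h \<otimes> e j then 1 else 0))"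
        using ij by (simp add: \<rho>_def scalar_prod_def lessThan_atLeast0)
      also have "\<dots> = (\<Sum>m<N. if m = m0 then if e i = g \<otimes> e m then 1 else 0 else 0)"
        using m0 e_inj[OF _ m0(1)] by (intro sum.cong) (auto simp: m0(2)[symmetric])
      also have "\<dots> = (if e i = g \<otimes> (h \<otimes> e j) then 1 else 0)" using m0 by simp
      also have "\<dots> = \<rho> (g \<otimes> h) $$ (i,j)" using ij gh eG by (simp add: \<rho>_def m_assoc)
      finally show "\<rho> (g \<otimes> h) $$ (i,j) = (\<rho> g * \<rho> h) $$ (i,j)" by simp
    qed (auto simp: \<rho>_def)
  qed (auto simp: \<rho>_def)
  moreover have mean: "mean_trace H \<rho> = of_nat N / of_nat (card H)" if "subgroup H G" for H
  proof -
    have HG: "H \<subseteq> carrier G" "\<one> \<in> H" using that by (auto simp: subgroup_def)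
    have "mat_trace (\<rho> g) = (if g = \<one> then of_nat N else 0)" if "g \<in> carrier G" for g
    proof -
      have "mat_trace (\<rho> g) = (\<Sum>i<N. if e i = g \<otimes> e i then 1 else 0)"
        by (subst mat_trace_sum[of _ N]) (auto simp: \<rho>_def)
      also have "\<dots> = (\<Sum>i<N. if g = \<one> then 1 else 0)"
        using that eG by (intro sum.cong) (auto simp: r_cancel_one')
      finally show ?thesis by simp
    qed
    then have "(\<Sum>g\<in>H. mat_trace (\<rho> g)) = (\<Sum>g\<in>H. if g = \<one> then of_nat N else 0)"
      using HG by (intro sum.cong) auto
    then show ?thesis
      using HG finite_subset[OF HG(1) assms(1)] by (simp add: mean_trace_def)
  qed
  moreover have "card M < N" using assms N(2)
    by (metis psubsetI psubset_card_mono subgroup.subset)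
  moreover have "card M > 0"
    using assms finite_subset[OF subgroup.subset[OF assms(2)]] subgroup.one_closed[OF assms(2)]
    by (auto simp: card_gt_0_iff)
  ultimately show thesis
    using that[of N \<rho>] mean[OF assms(2)] mean[OF subgroup_self] N by (auto simp: field_simps)
qed

text \<open>The sum of the matrices \<open>\<rho> g\<close> over \<open>M\<close> is unchanged by
  left multiplication with \<open>\<rho> h\<close> for \<open>h\<close> in \<open>M\<close>, so its
  columns are fixed by \<open>M\<close>. Its trace is nonzero, so some diagonal entry, and with it a
  column, is nonzero.\<close>

lemma subgroup_invariant_vector:
  assumes rep: "matrix_rep G n \<rho>" and M: "subgroup M G" and nz: "mean_trace M \<rho> \<noteq> 0"
  obtains v where "v \<in> carrier_vec n" "v \<noteq> 0\<^sub>v n" "\<And>g. g \<in> M \<Longrightarrow> \<rho> g *\<^sub>v v = v"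
proof -
  have MG: "M \<subseteq> carrier G" by (rule subgroup.subset[OF M])
  have R: "\<rho> g \<in> carrier_mat n n" if "g \<in> M" for g
    using rep that MG by (auto simp: matrix_rep_iff)
  have "(\<Sum>g\<in>M. mat_trace (\<rho> g)) = (\<Sum>j<n. \<Sum>g\<in>M. \<rho> g $$ (j,j))"
    by (subst sum.swap) (auto intro!: sum.cong mat_trace_sum R)
  then obtain j where j: "j < n" "(\<Sum>g\<in>M. \<rho> g $$ (j,j)) \<noteq> 0"
    using nz unfolding mean_trace_def by (metis (no_types, lifting) div_0 lessThan_iff sum.neutral)
  define v where "v = vec n (\<lambda>i. \<Sum>g\<in>M. \<rho> g $$ (i,j))"
  have "v $ j \<noteq> 0" using j by (simp add: v_def)
  then have "v \<noteq> 0\<^sub>v n" using j by auto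
  moreover have "\<rho> h *\<^sub>v v = v" if h: "h \<in> M" for h
  proof (rule eq_vecI)
    fix i assume "i < dim_vec v"
    then have i: "i < n" by (simp add: v_def)
    have "(\<rho> h *\<^sub>v v) $ i = (\<Sum>m<n. \<rho> h $$ (i,m) * (\<Sum>g\<in>M. \<rho> g $$ (m,j)))"
      using i R[OF h] by (simp add: v_def scalar_prod_def lessThan_atLeast0)
    also have "\<dots> = (\<Sum>g\<in>M. \<Sum>m<n. \<rho> h $$ (i,m) * \<rho> g $$ (m,j))"
      by (simp add: sum_distrib_left) (rule sum.swap)
    also have "\<dots> = (\<Sum>g\<in>M. (\<rho> h * \<rho> g) $$ (i,j))"
    proof (rule sum.cong)
      show "(\<Sum>m<n. \<rho> h $$ (i,m) * \<rho> g $$ (m,j)) = (\<rho> h * \<rho> g) $$ (i,j)" if "g \<in> M" for g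
        using i j R[OF h] R[OF that] by (simp add: scalar_prod_def lessThan_atLeast0)
    qed simp
    also have "\<dots> = (\<Sum>g\<in>M. \<rho> (h \<otimes> g) $$ (i,j))"
      using rep h MG by (intro sum.cong refl) (simp add: matrix_rep_iff subset_iff)
    \<comment> \<open>Left translation by \<open>h\<close> permutes \<open>M\<close>.\<close>
    also have "\<dots> = (\<Sum>g\<in>M. \<rho> g $$ (i,j))"
    proof (rule sum.reindex_bij_witness[where i = "\<lambda>g. inv h \<otimes> g" and j = "\<lambda>g. h \<otimes> g"])
    qed (use h M MG in \<open>auto simp: inv_solve_left m_assoc[symmetric] subgroup.m_closed
        subgroup.m_inv_closed subset_iff\<close>)
    finally show "(\<rho> h *\<^sub>v v) $ i = v $ i" using i by (simp add: v_def)
  qed (use R[OF h] in \<open>simp add: v_def\<close>)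
  ultimately show thesis using that[of v] by (simp add: v_def)
qed

text \<open>Since \<open>N\<close> is normal, the vectors fixed by \<open>N\<close> form a
  \<open>G\<close>-invariant subspace; it contains \<open>v \<noteq> 0\<close>, so by irreducibility
  it is the whole space.\<close>

lemma irreducible_rep_normal_invariant:
  assumes irr: "irreducible_rep G n \<rho>" and N: "N \<lhd> G"
    and v: "v \<in> carrier_vec n" "v \<noteq> 0\<^sub>v n" "\<And>g. g \<in> N \<Longrightarrow> \<rho> g *\<^sub>v v = v"
    and w: "w \<in> carrier_vec n" and g: "g \<in> N"
  shows "\<rho> g *\<^sub>v w = w"
proof -
  have rep: "matrix_rep G n \<rho>" using irr by (simp add: irreducible_rep_def)
  have NG: "N \<subseteq> carrier G" using N by (simp add: normal_imp_subgroup subgroup.subset)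
  have R: "\<rho> g \<in> carrier_mat n n" if "g \<in> carrier G" for g
    using rep that by (auto simp: matrix_rep_iff)
  define W where "W = {w \<in> carrier_vec n. \<forall>g\<in>N. \<rho> g *\<^sub>v w = w}"
  interpret vec_space "TYPE(complex)" n .
  have "\<rho> g *\<^sub>v 0\<^sub>v n = 0\<^sub>v n" if "g \<in> carrier G" for g
    using R[OF that] by (intro eq_vecI) auto
  then have "submodule class_ring W V"
    unfolding submodule_def
    using vec_module R NG
    by (auto simp: W_def module_vec_simps mult_add_distrib_mat_vec[of _ n n] mult_mat_vec[of _ n n] subset_iff)
  then have "subspace class_ring W V" using vec_vs by (simp add: subspace_def)
  moreover have "\<rho> h *\<^sub>v w \<in> W" if h: "h \<in> carrier G" and w: "w \<in> W" for h w
  proof -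
    have "\<rho> x *\<^sub>v (\<rho> h *\<^sub>v w) = \<rho> h *\<^sub>v w" if x: "x \<in> N" for x
    proof -
      have xG: "x \<in> carrier G" using x NG by auto
      have c: "inv h \<otimes> x \<otimes> h \<in> N" using normal.inv_op_closed1[OF N h x] .
      have "\<rho> x *\<^sub>v (\<rho> h *\<^sub>v w) = \<rho> (x \<otimes> h) *\<^sub>v w"
        using matrix_rep_mult_vec[OF rep xG h] w by (simp add: W_def)
      \<comment> \<open>Moving \<open>x\<close> past \<open>h\<close> replaces it by a conjugate,
        which lies in \<open>N\<close> and so fixes \<open>w\<close>.\<close>
      also have "x \<otimes> h = h \<otimes> (inv h \<otimes> x \<otimes> h)" using xG h by (simp add: m_assoc[symmetric])
      also have "\<rho> \<dots> *\<^sub>v w = \<rho> h *\<^sub>v w"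
        using matrix_rep_mult_vec[OF rep h, of "inv h \<otimes> x \<otimes> h" w] c w NG by (auto simp: W_def)
      finally show ?thesis .
    qed
    then show ?thesis using R[OF h] w by (auto simp: W_def)
  qed
  moreover have "W \<noteq> {0\<^sub>v n}" using v by (auto simp: W_def)
  ultimately have "W = carrier_vec n" using irr unfolding irreducible_rep_def by blast
  then show ?thesis using w g by (auto simp: W_def)
qed

text \<open>If a nonzero vector were fixed by \<open>G\<close>, the previous lemma with
  \<open>G\<close> as the normal subgroup would make all of \<open>G\<close> act trivially. Every
  trace would then be \<open>n\<close>, and so would the means over \<open>M\<close> and over
  \<open>G\<close>, against the gap.\<close>

lemma irreducible_rep_no_invariant_vector:
  assumes irr: "irreducible_rep G n \<rho>" and fin: "finite (carrier G)" and M: "subgroup M G"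
    and gap: "mean_trace M \<rho> \<noteq> mean_trace (carrier G) \<rho>"
    and v: "v \<in> carrier_vec n" "\<And>g. g \<in> carrier G \<Longrightarrow> \<rho> g *\<^sub>v v = v"
  shows "v = 0\<^sub>v n"
proof (rule ccontr)
  assume nz: "v \<noteq> 0\<^sub>v n"
  have rep: "matrix_rep G n \<rho>" using irr by (simp add: irreducible_rep_def)
  have "mat_trace (\<rho> g) = of_nat n" if g: "g \<in> carrier G" for g
  proof -
    have R: "\<rho> g \<in> carrier_mat n n" using rep g by (auto simp: matrix_rep_iff)
    have "\<rho> g $$ (i,i) = 1" if "i < n" for i
    proof -
      have "\<rho> g *\<^sub>v unit_vec n i = unit_vec n i"
        using irreducible_rep_normal_invariant[OF irr normal_self v(1) nz v(2) _ g] by simp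
      moreover have "(\<rho> g *\<^sub>v unit_vec n i) $ i = \<rho> g $$ (i,i)"
        using R that by simp
      ultimately show ?thesis using that by simp
    qed
    then show ?thesis using mat_trace_sum[OF R] by simp
  qed
  then have "mean_trace H \<rho> = of_nat n" if "subgroup H G" for H
  proof -
    assume tr: "\<And>g. g \<in> carrier G \<Longrightarrow> mat_trace (\<rho> g) = of_nat n"
    have "H \<subseteq> carrier G" "H \<noteq> {}" using that by (auto simp: subgroup_def)
    moreover from this have "card H > 0" using fin finite_subset by (auto simp: card_gt_0_iff)
    moreover have "(\<Sum>g\<in>H. mat_trace (\<rho> g)) = (\<Sum>g\<in>H. of_nat n)"
      using \<open>H \<subseteq> carrier G\<close> tr by (intro sum.cong) auto
    ultimately show ?thesis by (simp add: mean_trace_def)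
  qed
  then show False using gap M subgroup_self by metis
qed

text \<open>Frobenius reciprocity for the principal character. After exchanging the two sums, each
  conjugating element \<open>x\<close> contributes the sum of the character over \<open>M\<close>,
  because characters are class functions; the \<open>|G|\<close> equal contributions cancel the
  division by the group order.\<close>

lemma char_inner_induced_principal:
  assumes rep: "matrix_rep G n \<rho>" and fin: "finite (carrier G)" and M: "subgroup M G"
  shows "char_inner G (rep_character G \<rho>) (induced_char G M (principal_char M)) = mean_trace M \<rho>"
proof -
  let ?\<chi> = "\<lambda>g. mat_trace (\<rho> g)"
  have MG: "M \<subseteq> carrier G" by (rule subgroup.subset[OF M])
  have conj: "?\<chi> (inv x \<otimes> g \<otimes> x) = ?\<chi> g" if "x \<in> carrier G" "g \<in> carrier G" for x g
  proof -
    have R: "\<rho> x \<in> carrier_mat n n" "\<rho> g \<in> carrier_mat n n" "\<rho> (inv x) \<in> carrier_mat n n"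
      using rep that by (auto simp: matrix_rep_iff)
    have "\<rho> (inv x \<otimes> g \<otimes> x) = \<rho> (inv x \<otimes> g) * \<rho> x" using rep that by (simp add: matrix_rep_iff)
    then have "?\<chi> (inv x \<otimes> g \<otimes> x) = mat_trace (\<rho> x * \<rho> (inv x \<otimes> g))"
      using mat_trace_comm[of "\<rho> (inv x \<otimes> g)" n "\<rho> x"] R(1) rep that
      unfolding matrix_rep_iff by (metis inv_closed m_closed)
    also have "\<rho> x * \<rho> (inv x \<otimes> g) = \<rho> (x \<otimes> (inv x \<otimes> g))"
      using rep that by (simp add: matrix_rep_iff)
    also have "x \<otimes> (inv x \<otimes> g) = g" using that by (simp add: m_assoc[symmetric])
    finally show ?thesis .
  qed
  \<comment> \<open>The induced principal character takes real values, so the conjugation in the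
    inner product disappears.\<close>
  have ind: "cnj (induced_char G M (principal_char M) g) =
      (\<Sum>x\<in>carrier G. if x \<otimes> g \<otimes> inv x \<in> M then 1 else 0) / of_nat (card M)"
    if "g \<in> carrier G" for g
    using that by (simp add: induced_char_def principal_char_def if_distrib cong: if_cong)
  have "(\<Sum>g\<in>carrier G. ?\<chi> g * (\<Sum>x\<in>carrier G. if x \<otimes> g \<otimes> inv x \<in> M then 1 else 0))
      = (\<Sum>x\<in>carrier G. \<Sum>g\<in>carrier G. if x \<otimes> g \<otimes> inv x \<in> M then ?\<chi> g else 0)"
    by (subst sum.swap) (simp add: sum_distrib_left if_distrib cong: if_cong)
  also have "\<dots> = (\<Sum>x\<in>carrier G. \<Sum>m\<in>M. ?\<chi> m)"
  proof (rule sum.cong)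
    fix x assume x: "x \<in> carrier G"
    have "(\<Sum>g\<in>carrier G. if x \<otimes> g \<otimes> inv x \<in> M then ?\<chi> g else 0)
        = (\<Sum>g\<in>{g\<in>carrier G. x \<otimes> g \<otimes> inv x \<in> M}. ?\<chi> g)"
      using fin by (simp add: sum.inter_filter)
    \<comment> \<open>For fixed \<open>x\<close>, conjugation by \<open>x\<close> maps the
      \<open>g\<close> that occur bijectively onto \<open>M\<close> and preserves the
      character.\<close>
    also have "\<dots> = (\<Sum>m\<in>M. ?\<chi> m)"
    proof (rule sum.reindex_bij_witness[where i = "\<lambda>m. inv x \<otimes> m \<otimes> x"
          and j = "\<lambda>g. x \<otimes> g \<otimes> inv x"])
      show "?\<chi> (x \<otimes> g \<otimes> inv x) = ?\<chi> g" if "g \<in> {g\<in>carrier G. x \<otimes> g \<otimes> inv x \<in> M}" for g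
        using that x conj[of "inv x" g] by simp
      show "x \<otimes> (inv x \<otimes> m \<otimes> x) \<otimes> inv x = m" if "m \<in> M" for m
        using that x MG by (simp add: m_assoc subset_iff) (simp add: m_assoc[symmetric] subset_iff)
      show "inv x \<otimes> (x \<otimes> g \<otimes> inv x) \<otimes> x = g" if "g \<in> {g\<in>carrier G. x \<otimes> g \<otimes> inv x \<in> M}" for g
        using that x by (simp add: m_assoc) (simp add: m_assoc[symmetric])
      then show "inv x \<otimes> m \<otimes> x \<in> {g\<in>carrier G. x \<otimes> g \<otimes> inv x \<in> M}" if "m \<in> M" for m
        using that x MG by (auto simp: m_assoc subset_iff) (simp add: m_assoc[symmetric] subset_iff)
    qed auto
    finally show "(\<Sum>g\<in>carrier G. if x \<otimes> g \<otimes> inv x \<in> M then ?\<chi> g else 0) = (\<Sum>m\<in>M. ?\<chi> m)" .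
  qed simp
  finally have sum: "(\<Sum>g\<in>carrier G. ?\<chi> g * (\<Sum>x\<in>carrier G. if x \<otimes> g \<otimes> inv x \<in> M then 1 else 0))
      = of_nat (Coset.order G) * (\<Sum>m\<in>M. ?\<chi> m)" by (simp add: Coset.order_def)
  have "char_inner G (rep_character G \<rho>) (induced_char G M (principal_char M)) =
     (\<Sum>g\<in>carrier G. ?\<chi> g * ((\<Sum>x\<in>carrier G. if x \<otimes> g \<otimes> inv x \<in> M then 1 else 0) / of_nat (card M)))
       / of_nat (Coset.order G)"
    unfolding char_inner_def using ind by (simp add: rep_character_def)
  also have "\<dots> = (\<Sum>m\<in>M. ?\<chi> m) / of_nat (card M)"
    using fin unfolding times_divide_eq_right sum_divide_distrib[symmetric] sum
    by (auto simp: Coset.order_def)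
  finally show ?thesis by (simp add: mean_trace_def)
qed

end

section \<open>Supplements of normal subgroups of coprime index\<close>

text \<open>Orbit lengths divide \<open>p ^ a\<close>, hence are powers of \<open>p\<close>. Since
  \<open>p\<close> does not divide \<open>card E\<close>, some orbit length is prime to
  \<open>p\<close> and so equals 1.\<close>

lemma (in group) p_group_fixed_point:
  assumes p: "Factorial_Ring.prime p" and card: "Coset.order G = p ^ a"
    and fin: "finite E" and ndvd: "\<not> p dvd card E"
    and closed: "\<And>g x. g \<in> carrier G \<Longrightarrow> x \<in> E \<Longrightarrow> f g x \<in> E"
    and one: "\<And>x. x \<in> E \<Longrightarrow> f \<one> x = x"
    and mult: "\<And>g h x. g \<in> carrier G \<Longrightarrow> h \<in> carrier G \<Longrightarrow> x \<in> E \<Longrightarrow> f (g \<otimes> h) x = f g (f h x)"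
  obtains x where "x \<in> E" "\<And>g. g \<in> carrier G \<Longrightarrow> f g x = x"
proof -
  \<comment> \<open>The elements of \<open>BijGroup E\<close> are extensional on \<open>E\<close>,
    hence the restriction.\<close>
  define \<phi> where "\<phi> g = restrict (f g) E" for g
  have Bij: "\<phi> g \<in> Bij E" if g: "g \<in> carrier G" for g
  proof -
    have "f (inv g) (f g x) = x" "f g (f (inv g) x) = x" if "x \<in> E" for x
      using mult[of "inv g" g x] mult[of g "inv g" x] that g one by auto
    then have "bij_betw (f g) E E"
      using g closed by (intro bij_betw_byWitness[where f' = "f (inv g)"]) auto
    then show ?thesis by (simp add: Bij_def \<phi>_def bij_betw_restrict_eq)
  qed
  have "\<phi> \<in> hom G (BijGroup E)"
  proof (rule homI)
    fix g h assume gh: "g \<in> carrier G" "h \<in> carrier G"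
    show "\<phi> (g \<otimes> h) = \<phi> g \<otimes>\<^bsub>BijGroup E\<^esub> \<phi> h"
      using gh Bij mult closed by (auto simp: BijGroup_def compose_def \<phi>_def fun_eq_iff)
  qed (auto simp: BijGroup_def Bij)
  then interpret group_action G E \<phi>
    by (simp add: group_action_def group_hom_def group_hom_axioms_def group_BijGroup is_group)
  have finorb: "finite (orbits G E \<phi>)"
    using fin by (auto simp: orbits_def setcompr_eq_image)
  have "card E = (\<Sum>orb\<in>orbits G E \<phi>. card orb)"
    using disjoint_sum[OF fin, of "\<lambda>_. 1 :: nat"] by simp
  then have "\<exists>orb\<in>orbits G E \<phi>. \<not> p dvd card orb"
    using ndvd by (metis dvd_sum)
  then obtain x where x: "x \<in> E" and nd: "\<not> p dvd card (orbit G \<phi> x)" by (auto simp: orbits_def)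
  have "card (orbit G \<phi> x) dvd p ^ a"
    using orbit_stabilizer_theorem[OF x] card by (metis dvd_triv_left)
  then obtain i where "card (orbit G \<phi> x) = p ^ i"
    using p by (auto simp: divides_primepow_nat)
  then have "card (orbit G \<phi> x) = 1" using nd by (cases i) auto
  then have "orbit G \<phi> x = {x}" using orbit_refl[OF x] by (metis card_1_singletonE singletonD)
  then have "f g x = x" if "g \<in> carrier G" for g
    using that x unfolding orbit_def \<phi>_def by auto
  then show thesis using that x by blast
qed

text \<open>This set is the normalizer of \<open>P\<close>. For closure under inverses, conjugation
  by \<open>u\<close> is an injective map from the finite set \<open>P\<close> to itself, so it is
  onto and its inverse also preserves \<open>P\<close>.\<close>

lemma (in group) subgroup_conjugators:
  assumes P: "subgroup P G" and fin: "finite (carrier G)"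
  shows "subgroup {u \<in> carrier G. \<forall>x\<in>P. u \<otimes> x \<otimes> inv u \<in> P} G"
proof -
  have PG: "P \<subseteq> carrier G" by (rule subgroup.subset[OF P])
  define H where "H = {u \<in> carrier G. \<forall>x\<in>P. u \<otimes> x \<otimes> inv u \<in> P}"
  have mult: "u \<otimes> v \<in> H" if "u \<in> H" "v \<in> H" for u v
  proof -
    have "u \<otimes> v \<otimes> x \<otimes> inv (u \<otimes> v) \<in> P" if "x \<in> P" for x
    proof -
      have "u \<otimes> v \<otimes> x \<otimes> inv (u \<otimes> v) = u \<otimes> (v \<otimes> x \<otimes> inv v) \<otimes> inv u"
        using \<open>u \<in> H\<close> \<open>v \<in> H\<close> that PG by (auto simp: H_def m_assoc inv_mult_group)
      then show ?thesis using \<open>u \<in> H\<close> \<open>v \<in> H\<close> that by (auto simp: H_def)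
    qed
    then show ?thesis using that by (auto simp: H_def)
  qed
  have "inv u \<in> H" if u: "u \<in> H" for u
  proof -
    have uG: "u \<in> carrier G" using u by (simp add: H_def)
    have "inj_on (\<lambda>x. u \<otimes> x \<otimes> inv u) P" using uG PG by (auto simp: inj_on_def subset_iff)
    moreover have "(\<lambda>x. u \<otimes> x \<otimes> inv u) ` P \<subseteq> P" using u by (auto simp: H_def)
    ultimately have "(\<lambda>x. u \<otimes> x \<otimes> inv u) ` P = P"
      by (rule endo_inj_surj[OF finite_subset[OF PG fin], rotated])
    then have "inv u \<otimes> x \<otimes> inv (inv u) \<in> P" if x: "x \<in> P" for x
    proof -
      assume *: "(\<lambda>x. u \<otimes> x \<otimes> inv u) ` P = P"
      obtain y where y: "y \<in> P" "x = u \<otimes> y \<otimes> inv u" using x * by blast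
      then have "y \<in> carrier G" using PG by auto
      then have "inv u \<otimes> x \<otimes> inv (inv u) = y"
        using uG y(2) by (simp add: m_assoc) (simp add: m_assoc[symmetric])
      then show ?thesis using y(1) by simp
    qed
    then show ?thesis using uG by (simp add: H_def)
  qed
  then have "subgroup H G"
    using mult PG by (intro subgroupI) (auto simp: H_def intro!: exI[of _ \<one>])
  then show ?thesis by (simp add: H_def)
qed

lemma (in group) conjugate_subgroup:
  assumes "subgroup P G" "g \<in> carrier G"
  shows "subgroup ((\<lambda>x. g \<otimes> x \<otimes> inv g) ` P) G"
proof -
  have "(\<lambda>x. g \<otimes> x \<otimes> inv g) \<in> hom G G"
    using assms(2) by (intro homI) (auto simp: m_assoc, simp add: m_assoc[symmetric])
  then interpret c: group_hom G G "\<lambda>x. g \<otimes> x \<otimes> inv g"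
    by (simp add: group_hom_def group_hom_axioms_def is_group)
  show ?thesis using assms(1) by (rule c.subgroup_img_is_subgroup)
qed

text \<open>\<open>P\<close> is a Sylow subgroup of \<open>N\<close>, and so is its conjugate
  \<open>Q\<close> by \<open>g\<close>. Acting on the cosets of \<open>Q\<close> in
  \<open>N\<close>, whose number is prime to \<open>p\<close>, the \<open>p\<close>-group
  \<open>P\<close> fixes some \<open>Q #> n\<close>. Then \<open>n\<close> conjugates
  \<open>P\<close> into \<open>Q\<close>, so \<open>inv g \<otimes> n\<close> normalizes
  \<open>P\<close>, which exhibits \<open>g\<close> in the product.\<close>

lemma (in group) frattini_argument:
  assumes N: "N \<lhd> G" and fin: "finite (carrier G)"
    and P: "subgroup P G" "P \<subseteq> N" and p: "Factorial_Ring.prime p"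
    and card: "card P = p ^ a" "card N = p ^ a * m" "\<not> p dvd m"
  shows "N <#> {u \<in> carrier G. \<forall>x\<in>P. u \<otimes> x \<otimes> inv u \<in> P} = carrier G"
proof
  let ?H = "{u \<in> carrier G. \<forall>x\<in>P. u \<otimes> x \<otimes> inv u \<in> P}"
  have NG: "subgroup N G" "N \<subseteq> carrier G"
    using N by (simp_all add: normal_imp_subgroup subgroup.subset)
  have PG: "P \<subseteq> carrier G" using P NG by auto
  show "N <#> ?H \<subseteq> carrier G" using NG by (intro setmult_subset_G) auto
  show "carrier G \<subseteq> N <#> ?H"
  proof
    fix g assume g: "g \<in> carrier G"
    define Q where "Q = (\<lambda>x. g \<otimes> x \<otimes> inv g) ` P"
    have Qsub: "subgroup Q G" unfolding Q_def by (rule conjugate_subgroup[OF P(1) g])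
    have QN: "Q \<subseteq> N" unfolding Q_def using P(2) normal.inv_op_closed2[OF N g] by auto
    have cardQ: "card Q = p ^ a" unfolding Q_def card(1)[symmetric]
      by (rule card_image) (use g PG in \<open>auto simp: inj_on_def subset_iff\<close>)
    let ?N = "G\<lparr>carrier := N\<rparr>"
    define E where "E = rcosets\<^bsub>?N\<^esub> Q"
    interpret NN: group ?N by (rule subgroup.subgroup_is_group[OF NG(1) is_group])
    have QsubN: "subgroup Q ?N" by (rule subgroup_incl[OF Qsub NG(1) QN])
    have "card E * p ^ a = p ^ a * m"
      using NN.lagrange[OF QsubN] card cardQ by (simp add: E_def Coset.order_def)
    then have "\<not> p dvd card E" using card(3) p by (auto simp: prime_gt_0_nat)
    have finE: "finite E" using \<open>\<not> p dvd card E\<close> card.infinite by fastforce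
    have E: "E = {Q #> n | n. n \<in> N}" by (auto simp: E_def RCOSETS_def)
    let ?P = "G\<lparr>carrier := P\<rparr>"
    interpret PP: group ?P by (rule subgroup.subgroup_is_group[OF P(1) is_group])
    have QG: "Q \<subseteq> carrier G" using QN NG by auto
    \<comment> \<open>Right multiplication by \<open>inv x\<close> rather than by \<open>x\<close>
      makes this a left action, as the fixed point lemma requires.\<close>
    obtain C where C: "C \<in> E" "\<And>x. x \<in> P \<Longrightarrow> C #> inv x = C"
    proof (rule PP.p_group_fixed_point[OF p _ finE \<open>\<not> p dvd card E\<close>, of a "\<lambda>x C. C #> inv x"])
      show "Coset.order ?P = p ^ a" using card by (simp add: Coset.order_def)
      show "C #> inv x \<in> E" if x: "x \<in> carrier ?P" and C: "C \<in> E" for x C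
      proof -
        obtain n where n: "n \<in> N" "C = Q #> n" using C E by auto
        have x: "x \<in> N" using x P by auto
        then have "n \<otimes> inv x \<in> N" using n NG by (simp add: subgroup.m_closed subgroup.m_inv_closed)
        moreover have "C #> inv x = Q #> (n \<otimes> inv x)"
          using coset_mult_assoc[OF QG, of n "inv x"] n x NG by auto
        ultimately show ?thesis using E by auto
      qed
      have CG: "C \<subseteq> carrier G" if "C \<in> E" for C
        using that QG NG by (auto simp: E r_coset_def)
      show "C #> inv \<one>\<^bsub>?P\<^esub> = C" if "C \<in> E" for C using CG[OF that] by simp
      show "C #> inv (x \<otimes>\<^bsub>?P\<^esub> y) = C #> inv y #> inv x"
        if "x \<in> carrier ?P" "y \<in> carrier ?P" "C \<in> E" for x y C
        using that CG[OF that(3)] PG by (auto simp: coset_mult_assoc inv_mult_group subset_iff)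
    qed (use that in auto)
    obtain n where n: "n \<in> N" "C = Q #> n" using C(1) E by auto
    have nG: "n \<in> carrier G" using n NG by auto
    define u where "u = inv g \<otimes> n"
    have uG: "u \<in> carrier G" using g nG by (simp add: u_def)
    have "u \<otimes> x \<otimes> inv u \<in> P" if x: "x \<in> P" for x
    proof -
      have xG: "x \<in> carrier G" using x PG by auto
      have "inv x \<in> P" using x P by (simp add: subgroup.m_inv_closed)
      then have "(Q #> n) #> x = Q #> n" using C(2)[of "inv x"] n xG by simp
      \<comment> \<open>That \<open>x\<close> fixes the coset \<open>Q #> n\<close> means exactly
        that \<open>n \<otimes> x \<otimes> inv n\<close> lies in \<open>Q\<close>.\<close>
      then have "Q #> (n \<otimes> x) = Q #> n" using QG nG xG by (simp add: coset_mult_assoc)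
      then have "n \<otimes> x \<in> Q #> n" using rcos_self[OF _ Qsub, of "n \<otimes> x"] nG xG by simp
      then have "n \<otimes> x \<otimes> inv n \<in> Q" using subgroup.rcos_module[OF Qsub is_group nG] nG xG by simp
      then obtain y where y: "y \<in> P" "n \<otimes> x \<otimes> inv n = g \<otimes> y \<otimes> inv g" by (auto simp: Q_def)
      then have yG: "y \<in> carrier G" using PG by auto
      have "u \<otimes> x \<otimes> inv u = inv g \<otimes> (n \<otimes> x \<otimes> inv n) \<otimes> g"
        using g nG xG by (simp add: u_def m_assoc inv_mult_group)
      also have "\<dots> = y" unfolding y(2) using g yG by (simp add: m_assoc) (simp add: m_assoc[symmetric])
      finally show ?thesis using y by simp
    qed
    then have "u \<in> ?H" using uG by simp
    then have "inv u \<in> ?H" by (rule subgroup.m_inv_closed[OF subgroup_conjugators[OF P(1) fin]])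
    moreover have "g = n \<otimes> inv u" using g nG by (simp add: u_def inv_mult_group m_assoc[symmetric])
    ultimately show "g \<in> N <#> ?H" using n by (auto simp: set_mult_def)
  qed
qed

section \<open>Complements of abelian normal subgroups of coprime index\<close>

lemma (in comm_group) finprod_endomorphism:
  assumes h: "h \<in> hom G G" and f: "f \<in> A \<rightarrow> carrier G"
  shows "h (finprod G f A) = finprod G (\<lambda>x. h (f x)) A"
  using f
proof (induction A rule: infinite_finite_induct)
  case (insert x A)
  then have "f x \<in> carrier G" "f \<in> A \<rightarrow> carrier G" by auto
  then show ?case using insert h by (simp add: hom_mult hom_in_carrier Pi_def)
qed (use h is_group in \<open>auto intro!: hom_one\<close>)

lemma (in group) coprime_pow_eq_one:
  assumes "finite (carrier G)" "coprime (Coset.order G) m" "x \<in> carrier G" "x [^] m = \<one>"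
  shows "x = \<one>"
proof -
  have "ord x dvd m" using assms(3,4) by (simp add: pow_eq_id)
  moreover have "ord x dvd Coset.order G" using assms by (simp add: ord_dvd_group_order)
  ultimately have "ord x = 1" using assms(2) by (metis coprime_common_divisor_nat nat_dvd_1_iff_1 coprime_def)
  then show ?thesis using ord_eq_1[OF assms(3)] by simp
qed

text \<open>In an abelian group the power map is a homomorphism; by the preceding lemma its kernel
  is trivial, and an injective self-map of a finite set is onto.\<close>

lemma (in comm_group) coprime_pow_surj:
  assumes fin: "finite (carrier G)" and cop: "coprime (Coset.order G) m" and y: "y \<in> carrier G"
  shows "\<exists>x\<in>carrier G. x [^] m = y"
proof -
  have "inj_on (\<lambda>x. x [^] m) (carrier G)"
  proof (rule inj_onI)
    fix x z assume xz: "x \<in> carrier G" "z \<in> carrier G" "x [^] m = z [^] m"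
    then have "(x \<otimes> inv z) [^] m = \<one>" by (simp add: nat_pow_distrib nat_pow_inv)
    then have "x \<otimes> inv z = \<one>" using coprime_pow_eq_one[OF fin cop] xz by simp
    then show "x = z" using xz by (simp add: inv_solve_right')
  qed
  moreover have "(\<lambda>x. x [^] m) ` carrier G \<subseteq> carrier G" by auto
  ultimately have "(\<lambda>x. x [^] m) ` carrier G = carrier G" by (rule endo_inj_surj[OF fin, rotated])
  then show ?thesis using y by (metis imageE)
qed

text \<open>With \<open>s\<close> a choice of coset representatives, \<open>f g = \<Prod>\<^sub>C g s(C) s(gC)\<^sup>-\<^sup>1\<close> is a crossed
  homomorphism \<open>G \<rightarrow> N\<close> that restricts to the power map \<open>n \<mapsto> n\<^sup>m\<close> on \<open>N\<close>; its kernel is a complement.\<close>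
lemma (in group) abelian_normal_complement:
  assumes N: "N \<lhd> G" and fin: "finite (carrier G)"
    and comm: "\<And>x y. x \<in> N \<Longrightarrow> y \<in> N \<Longrightarrow> x \<otimes> y = y \<otimes> x"
    and cop: "coprime (card N) (card (rcosets N))"
  obtains H where "subgroup H G" "H \<inter> N = {\<one>}" "N <#> H = carrier G"
proof -
  interpret N: normal N G by (rule N)
  have NG: "N \<subseteq> carrier G" by (rule N.subset)
  interpret Q: group "G Mod N" by (rule N.factorgroup_is_group)
  interpret A: comm_group "G\<lparr>carrier := N\<rparr>"
    by (rule group.group_comm_groupI[OF N.subgroup_is_group[OF is_group]]) (simp add: comm)
  let ?A = "G\<lparr>carrier := N\<rparr>"
  define R where "R = rcosets N"
  define m where "m = card R"
  have carQ: "carrier (G Mod N) = R" by (simp add: FactGroup_def R_def)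
  have finR: "finite R" using fin by (simp add: R_def RCOSETS_def)
  define s where "s C = (SOME x. x \<in> C)" for C :: "'a set"
  have s: "s C \<in> carrier G" "N #> s C = C" if C: "C \<in> R" for C
  proof -
    obtain x where x: "x \<in> carrier G" "C = N #> x" using C by (auto simp: R_def RCOSETS_def)
    have "s C \<in> C" unfolding s_def using x rcos_self[OF x(1) N.subgroup_axioms] by (intro someI) simp
    then show "s C \<in> carrier G" "N #> s C = C"
      using x repr_independence[of "s C" N x] N.subgroup_axioms N.elemrcos_carrier[OF is_group x(1)]
      by auto
  qed
  \<comment> \<open>The action of \<open>G\<close> on the cosets of \<open>N\<close>, written as
    multiplication in the quotient group.\<close>
  define T where "T g C = (N #> g) <#> C" for g C
  have TR: "T g C \<in> R" and T_eq: "T g C = N #> (g \<otimes> s C)" if "g \<in> carrier G" "C \<in> R" for g C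
  proof -
    show "T g C = N #> (g \<otimes> s C)"
      using N.rcos_sum[of g "s C"] s[OF that(2)] that(1) by (simp add: T_def)
    then show "T g C \<in> R" using s[OF that(2)] that(1) NG by (simp add: R_def rcosetsI)
  qed
  have T_mult: "T (g \<otimes> h) C = T g (T h C)" if "g \<in> carrier G" "h \<in> carrier G" and C: "C \<in> R" for g h C
  proof -
    obtain x where x: "x \<in> carrier G" "C = N #> x" using C by (auto simp: R_def RCOSETS_def)
    then show ?thesis using that by (simp add: T_def N.rcos_sum m_assoc)
  qed
  have T_triv: "T n C = C" if "n \<in> N" "C \<in> R" for n C
    using that N.rcosets_mult_eq[of C] N.rcos_const[OF is_group] by (simp add: T_def R_def)
  have T_bij: "bij_betw (T g) R R" if g: "g \<in> carrier G" for g
  proof (rule bij_betw_byWitness[where f' = "T (inv g)"])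
    show "\<forall>C\<in>R. T (inv g) (T g C) = C" "\<forall>C\<in>R. T g (T (inv g) C) = C"
      using g T_triv[OF N.one_closed] by (simp_all add: T_mult[symmetric])
  qed (use g TR in auto)
  define c where "c g C = g \<otimes> s C \<otimes> inv (s (T g C))" for g C
  have cN: "c g C \<in> N" if "g \<in> carrier G" "C \<in> R" for g C
  proof -
    have sT: "s (T g C) \<in> carrier G" "N #> s (T g C) = N #> (g \<otimes> s C)"
      using s[OF TR[OF that]] T_eq[OF that] by auto
    have "g \<otimes> s C \<in> N #> s (T g C)"
      using sT(2) rcos_self[OF _ N.subgroup_axioms, of "g \<otimes> s C"] s[OF that(2)] that by simp
    then show ?thesis
      using N.rcos_module[OF is_group sT(1)] s[OF that(2)] that by (simp add: c_def)
  qed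
  define f where "f g = finprod ?A (c g) R" for g
  have fN: "f g \<in> N" if "g \<in> carrier G" for g
    using A.finprod_closed[of "c g" R] cN[OF that] by (auto simp: f_def)
  have conj_hom: "(\<lambda>x. g \<otimes> x \<otimes> inv g) \<in> hom ?A ?A" if "g \<in> carrier G" for g
  proof (rule homI)
    show "g \<otimes> x \<otimes> inv g \<in> carrier ?A" if "x \<in> carrier ?A" for x
      using that \<open>g \<in> carrier G\<close> N.inv_op_closed2 by simp
    show "g \<otimes> (x \<otimes>\<^bsub>?A\<^esub> y) \<otimes> inv g = (g \<otimes> x \<otimes> inv g) \<otimes>\<^bsub>?A\<^esub> (g \<otimes> y \<otimes> inv g)"
      if "x \<in> carrier ?A" "y \<in> carrier ?A" for x y
    proof -
      have "x \<in> carrier G" "y \<in> carrier G" using that NG by auto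
      moreover have "(g \<otimes> x \<otimes> inv g) \<otimes> (g \<otimes> y \<otimes> inv g) = g \<otimes> x \<otimes> (inv g \<otimes> g) \<otimes> y \<otimes> inv g"
        using calculation \<open>g \<in> carrier G\<close> by (simp only: m_assoc m_closed inv_closed)
      ultimately show ?thesis using \<open>g \<in> carrier G\<close> by (simp add: m_assoc)
    qed
  qed
  \<comment> \<open>The factor of \<open>g \<otimes> h\<close> at \<open>C\<close> splits into the
    conjugate by \<open>g\<close> of the factor of \<open>h\<close> at \<open>C\<close> and the
    factor of \<open>g\<close> at \<open>T h C\<close>. As \<open>T h\<close> permutes the cosets,
    the product of the latter factors is again \<open>f g\<close>.\<close>
  have f_mult: "f (g \<otimes> h) = (g \<otimes> f h \<otimes> inv g) \<otimes> f g"
    if gh: "g \<in> carrier G" "h \<in> carrier G" for g h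
  proof -
    have c_eq: "c (g \<otimes> h) C = (g \<otimes> c h C \<otimes> inv g) \<otimes> c g (T h C)" if C: "C \<in> R" for C
    proof -
      let ?a = "s C" and ?b = "s (T h C)" and ?d = "s (T g (T h C))"
      have G: "?a \<in> carrier G" "?b \<in> carrier G" "?d \<in> carrier G"
        using s(1)[OF C] s(1)[OF TR[OF gh(2) C]] s(1)[OF TR[OF gh(1) TR[OF gh(2) C]]] by auto
      have "(g \<otimes> (h \<otimes> ?a \<otimes> inv ?b) \<otimes> inv g) \<otimes> (g \<otimes> ?b \<otimes> inv ?d)
          = g \<otimes> h \<otimes> ?a \<otimes> (inv ?b \<otimes> (inv g \<otimes> g) \<otimes> ?b) \<otimes> inv ?d"
        using G gh by (simp only: m_assoc m_closed inv_closed)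
      also have "\<dots> = g \<otimes> h \<otimes> ?a \<otimes> inv ?d" using G gh by simp
      finally show ?thesis by (simp add: c_def T_mult[OF gh C])
    qed
    have "f (g \<otimes> h) = finprod ?A (\<lambda>C. (g \<otimes> c h C \<otimes> inv g) \<otimes>\<^bsub>?A\<^esub> c g (T h C)) R"
      unfolding f_def
    proof (rule A.finprod_cong'[OF refl])
      show "(\<lambda>C. (g \<otimes> c h C \<otimes> inv g) \<otimes>\<^bsub>?A\<^esub> c g (T h C)) \<in> R \<rightarrow> carrier ?A"
        using gh cN TR N.inv_op_closed2 by (auto intro!: N.m_closed)
    qed (simp add: c_eq)
    also have "\<dots> = finprod ?A (\<lambda>C. g \<otimes> c h C \<otimes> inv g) R \<otimes>\<^bsub>?A\<^esub> finprod ?A (\<lambda>C. c g (T h C)) R"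
      using gh cN TR N.inv_op_closed2 by (intro A.finprod_multf) auto
    also have "finprod ?A (\<lambda>C. g \<otimes> c h C \<otimes> inv g) R = g \<otimes> f h \<otimes> inv g"
      unfolding f_def
      using A.finprod_endomorphism[OF conj_hom[OF gh(1)], of "c h" R] cN[OF gh(2)] by auto
    also have "finprod ?A (\<lambda>C. c g (T h C)) R = f g"
      using A.finprod_reindex[of "c g" "T h" R] T_bij[OF gh(2)] cN[OF gh(1)]
      by (auto simp: f_def bij_betw_def)
    finally show ?thesis by simp
  qed
  have f_N: "f n = n [^] m" if n: "n \<in> N" for n
  proof -
    have nG: "n \<in> carrier G" using n NG by auto
    \<comment> \<open>Elements of \<open>N\<close> fix every coset, so each factor
      \<open>c n C\<close> reduces to \<open>n\<close>.\<close>
    have "f n = finprod ?A (\<lambda>C. n) R"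
      unfolding f_def using n nG T_triv[OF n] s
      by (intro A.finprod_cong') (auto simp: c_def m_assoc)
    also have "\<dots> = n [^]\<^bsub>?A\<^esub> m" using A.finprod_const[of n R] n by (simp add: m_def)
    finally show ?thesis by (simp add: nat_pow_consistent[symmetric])
  qed
  have pow_triv: "n = \<one>" if "n \<in> N" "n [^] m = \<one>" for n
    using A.coprime_pow_eq_one[of m n] that cop finite_subset[OF NG fin]
    by (simp add: m_def R_def Coset.order_def nat_pow_consistent[symmetric])
  have pow_surj: "\<exists>n\<in>N. n [^] m = y" if "y \<in> N" for y
    using A.coprime_pow_surj[of m y] that cop finite_subset[OF NG fin]
    by (simp add: m_def R_def Coset.order_def nat_pow_consistent[symmetric])
  define H where "H = {g \<in> carrier G. f g = \<one>}"
  have f1: "f \<one> = \<one>" using f_N[OF N.one_closed] by simp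
  have "subgroup H G"
  proof (rule subgroupI)
    show "inv g \<in> H" if "g \<in> H" for g
    proof -
      have g: "g \<in> carrier G" "f g = \<one>" using that by (auto simp: H_def)
      have fi: "f (inv g) \<in> carrier G" using fN[of "inv g"] g NG by auto
      have "\<one> = g \<otimes> f (inv g) \<otimes> inv g" using f_mult[of g "inv g"] g fi f1 by simp
      then have "f (inv g) = inv g \<otimes> \<one> \<otimes> g" using g fi
        by (metis inv_solve_left inv_solve_right m_closed one_closed inv_closed m_assoc r_one)
      then show ?thesis using g by (simp add: H_def)
    qed
    show "g \<otimes> h \<in> H" if "g \<in> H" "h \<in> H" for g h
      using that f_mult[of g h] by (auto simp: H_def)
  qed (use f1 in \<open>auto simp: H_def\<close>)
  moreover have "H \<inter> N = {\<one>}" using pow_triv f_N f1 by (auto simp: H_def)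
  moreover have "N <#> H = carrier G"
  proof
    show "N <#> H \<subseteq> carrier G" using NG by (intro setmult_subset_G) (auto simp: H_def)
    show "carrier G \<subseteq> N <#> H"
    proof
      fix g assume g: "g \<in> carrier G"
      have fg: "f g \<in> N" using fN[OF g] .
      \<comment> \<open>\<open>n\<close> is chosen to cancel \<open>f g\<close>: \<open>N\<close> is
        abelian, so the crossed homomorphism rule gives
        \<open>f (n \<otimes> g) = f g \<otimes> n [^] m = \<one>\<close>, which puts
        \<open>n \<otimes> g\<close> into the kernel \<open>H\<close>.\<close>
      then obtain n where n: "n \<in> N" "n [^] m = inv (f g)" using pow_surj[of "inv (f g)"] by auto
      have nG: "n \<in> carrier G" using n NG by auto
      have "n \<otimes> f g \<otimes> inv n = f g"
        using comm[OF n(1) fg] nG fg NG by (auto simp: m_assoc)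
      then have "f (n \<otimes> g) = \<one>" using f_mult[OF nG g] f_N[OF n(1)] n(2) fg NG by auto
      then have "n \<otimes> g \<in> H" using nG g by (simp add: H_def)
      moreover have "g = inv n \<otimes> (n \<otimes> g)" using nG g by (simp add: m_assoc[symmetric])
      ultimately show "g \<in> N <#> H" using n by (force simp: set_mult_def)
    qed
  qed
  ultimately show thesis using that by blast
qed

section \<open>Supplements of minimal normal subgroups\<close>

text \<open>The group acts by conjugation on its \<open>p ^ a - 1\<close> nonidentity elements. This
  number is prime to \<open>p\<close>, so there is a fixed point, that is, a nontrivial central
  element.\<close>

lemma (in group) p_group_center_nontrivial:
  assumes p: "Factorial_Ring.prime p" and card: "Coset.order G = p ^ a" and a: "0 < a"
  obtains z where "z \<in> carrier G" "z \<noteq> \<one>" "\<And>x. x \<in> carrier G \<Longrightarrow> x \<otimes> z = z \<otimes> x"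
proof -
  have fin: "finite (carrier G)"
    using card p by (metis order_gt_0_iff_finite prime_gt_0_nat zero_less_power)
  have "card (carrier G - {\<one>}) = p ^ a - 1" using card fin by (simp add: Coset.order_def)
  moreover have "\<not> p dvd p ^ a - 1"
  proof
    assume "p dvd p ^ a - 1"
    moreover have "p dvd p ^ a" using a by simp
    moreover have "p ^ a \<ge> 1" using prime_ge_1_nat[OF p] by simp
    ultimately have "p dvd 1" by (metis dvd_diffD1)
    then show False using p by (simp add: prime_nat_iff)
  qed
  ultimately have nd: "\<not> p dvd card (carrier G - {\<one>})" by simp
  obtain z where z: "z \<in> carrier G - {\<one>}" "\<And>x. x \<in> carrier G \<Longrightarrow> x \<otimes> z \<otimes> inv x = z"
  proof (rule p_group_fixed_point[OF p card _ nd, of "\<lambda>x z. x \<otimes> z \<otimes> inv x"])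
    show "x \<otimes> z \<otimes> inv x \<in> carrier G - {\<one>}" if "x \<in> carrier G" "z \<in> carrier G - {\<one>}" for x z
      using that by (auto simp: inv_solve_right')
    show "x \<otimes> y \<otimes> z \<otimes> inv (x \<otimes> y) = x \<otimes> (y \<otimes> z \<otimes> inv y) \<otimes> inv x"
      if "x \<in> carrier G" "y \<in> carrier G" "z \<in> carrier G - {\<one>}" for x y z
      using that by (simp add: inv_mult_group m_assoc)
  qed (use fin in auto)
  have "x \<otimes> z = z \<otimes> x" if "x \<in> carrier G" for x
  proof -
    have "x \<otimes> z = x \<otimes> z \<otimes> inv x \<otimes> x" using z(1) that by (simp add: m_assoc)
    then show ?thesis using z(2)[OF that] by simp
  qed
  then show thesis using that z(1) by blast
qed

text \<open>Take a nontrivial Sylow subgroup \<open>P\<close> of \<open>N\<close>. By the Frattini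
  argument its normalizer supplements \<open>N\<close>. If the normalizer is all of
  \<open>G\<close>, minimality gives \<open>N = P\<close>; the center of this \<open>p\<close>-group
  is nontrivial and normal in \<open>G\<close>, so \<open>N\<close> is abelian and has a complement
  by coprimality.\<close>

lemma (in group) minimal_normal_coprime_supplement:
  assumes N: "N \<lhd> G" and fin: "finite (carrier G)" and nontriv: "N \<noteq> {\<one>}"
    and cop: "coprime (card N) (card (rcosets N))"
    and minimal: "\<And>L. L \<lhd> G \<Longrightarrow> L \<subseteq> N \<Longrightarrow> L = {\<one>} \<or> L = N"
  obtains H where "subgroup H G" "H \<noteq> carrier G" "N <#> H = carrier G"
proof -
  have Nsub: "subgroup N G" and NG: "N \<subseteq> carrier G"
    using N by (simp_all add: normal_imp_subgroup subgroup.subset)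
  have finN: "finite N" using finite_subset[OF NG fin] .
  have "card N \<noteq> 1" using nontriv subgroup.one_closed[OF Nsub] by (auto simp: card_1_singleton_iff)
  then obtain p where p: "Factorial_Ring.prime p" "p dvd card N" using prime_factor_nat by blast
  have cN: "card N > 0" using finN subgroup.one_closed[OF Nsub] by (auto simp: card_gt_0_iff)
  define a where "a = multiplicity p (card N)"
  obtain m where m: "card N = p ^ a * m" "\<not> p dvd m"
    using multiplicity_decompose'[of "card N" p] p cN by (auto simp: a_def prime_nat_iff)
  have a: "a > 0" using m p by (cases a) auto
  let ?N = "G\<lparr>carrier := N\<rparr>"
  interpret NN: group ?N by (rule subgroup.subgroup_is_group[OF Nsub is_group])
  obtain P where P: "subgroup P ?N" "card P = p ^ a"
    using sylow_thm[OF p(1) NN.is_group, of a m] m finN by (auto simp: Coset.order_def)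
  have PN: "P \<subseteq> N" using subgroup.subset[OF P(1)] by simp
  have Psub: "subgroup P G" using incl_subgroup[OF Nsub P(1)] .
  define K where "K = {u \<in> carrier G. \<forall>x\<in>P. u \<otimes> x \<otimes> inv u \<in> P}"
  have K: "subgroup K G" "N <#> K = carrier G"
    unfolding K_def using subgroup_conjugators[OF Psub fin]
      frattini_argument[OF N fin Psub PN p(1) P(2) m] by auto
  show thesis
  proof (cases "K = carrier G")
    case False
    then show thesis using that K by blast
  next
    case True
    then have "P \<lhd> G" using Psub by (intro normal_invI) (auto simp: K_def)
    moreover have "P \<noteq> {\<one>}"
    proof
      assume "P = {\<one>}"
      then have "p ^ a = 1" using P(2) by simp
      then show False using a p(1) by (simp add: prime_nat_iff)
    qed
    ultimately have NP: "N = P" using minimal PN by blast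
    \<comment> \<open>The center of \<open>N\<close>. It is shown to be normal in \<open>G\<close>,
      so minimality forces it to be \<open>N\<close>.\<close>
    define Z where "Z = {z \<in> N. \<forall>x\<in>N. x \<otimes> z = z \<otimes> x}"
    obtain z where z: "z \<in> N" "z \<noteq> \<one>" "\<And>x. x \<in> N \<Longrightarrow> x \<otimes> z = z \<otimes> x"
      using NN.p_group_center_nontrivial[OF p(1) _ a] P(2) NP by (auto simp: Coset.order_def)
    have conj_N: "inv g \<otimes> x \<otimes> g \<in> N" if "g \<in> carrier G" "x \<in> N" for g x
      using normal.inv_op_closed1[OF N that] .
    have "subgroup Z G"
    proof (rule subgroupI)
      show "Z \<subseteq> carrier G" using NG by (auto simp: Z_def)
      show "Z \<noteq> {}" using z by (auto simp: Z_def)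
      show "inv y \<in> Z" if "y \<in> Z" for y
      proof -
        have y: "y \<in> N" "y \<in> carrier G" using that NG by (auto simp: Z_def)
        have "x \<otimes> inv y = inv y \<otimes> x" if "x \<in> N" for x
        proof -
          have x: "x \<in> carrier G" "x \<otimes> y = y \<otimes> x" using that \<open>y \<in> Z\<close> NG by (auto simp: Z_def)
          have "inv y \<otimes> x = inv y \<otimes> (x \<otimes> y) \<otimes> inv y" using x(1) y by (simp add: m_assoc)
          also have "\<dots> = x \<otimes> inv y" unfolding x(2) using x(1) y by (simp add: m_assoc[symmetric])
          finally show ?thesis by simp
        qed
        moreover have "inv y \<in> N" using subgroup.m_inv_closed[OF Nsub y(1)] .
        ultimately show ?thesis unfolding Z_def by blast
      qed
      show "y \<otimes> y' \<in> Z" if "y \<in> Z" "y' \<in> Z" for y y'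
      proof -
        have "x \<otimes> (y \<otimes> y') = y \<otimes> y' \<otimes> x" if "x \<in> N" for x
        proof -
          have G: "x \<in> carrier G" "y \<in> carrier G" "y' \<in> carrier G"
            using that \<open>y \<in> Z\<close> \<open>y' \<in> Z\<close> NG by (auto simp: Z_def)
          have c: "x \<otimes> y = y \<otimes> x" "x \<otimes> y' = y' \<otimes> x"
            using that \<open>y \<in> Z\<close> \<open>y' \<in> Z\<close> unfolding Z_def by blast+
          have "x \<otimes> (y \<otimes> y') = (x \<otimes> y) \<otimes> y'" using G by (simp add: m_assoc)
          also have "\<dots> = y \<otimes> (x \<otimes> y')" unfolding c(1) using G by (simp add: m_assoc)
          also have "\<dots> = y \<otimes> y' \<otimes> x" unfolding c(2) using G by (simp add: m_assoc)
          finally show ?thesis .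
        qed
        moreover have "y \<otimes> y' \<in> N"
          using that subgroup.m_closed[OF Nsub, of y y'] unfolding Z_def by blast
        ultimately show ?thesis unfolding Z_def by blast
      qed
    qed
    moreover have "g \<otimes> y \<otimes> inv g \<in> Z" if g: "g \<in> carrier G" and y: "y \<in> Z" for g y
    proof -
      have yG: "y \<in> carrier G" using y NG by (auto simp: Z_def)
      have "x \<otimes> (g \<otimes> y \<otimes> inv g) = g \<otimes> y \<otimes> inv g \<otimes> x" if x: "x \<in> N" for x
      proof -
        have xG: "x \<in> carrier G" using x NG by auto
        \<comment> \<open>Commuting \<open>x\<close> with the conjugate of \<open>y\<close> by
          \<open>g\<close> amounts to commuting \<open>y\<close> with the conjugate of
          \<open>x\<close> by \<open>inv g\<close>, which lies in \<open>N\<close> again.\<close>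
        have "x \<otimes> (g \<otimes> y \<otimes> inv g) = g \<otimes> ((inv g \<otimes> x \<otimes> g) \<otimes> y) \<otimes> inv g"
          using g xG yG by (simp add: m_assoc) (simp add: m_assoc[symmetric])
        also have "(inv g \<otimes> x \<otimes> g) \<otimes> y = y \<otimes> (inv g \<otimes> x \<otimes> g)"
          using y conj_N[OF g x] unfolding Z_def by blast
        also have "g \<otimes> (y \<otimes> (inv g \<otimes> x \<otimes> g)) \<otimes> inv g = g \<otimes> y \<otimes> inv g \<otimes> x"
          using g xG yG by (simp add: m_assoc)
        finally show ?thesis .
      qed
      moreover have "g \<otimes> y \<otimes> inv g \<in> N"
        using normal.inv_op_closed2[OF N g, of y] y by (simp add: Z_def)
      ultimately show ?thesis unfolding Z_def by blast
    qed
    ultimately have "Z \<lhd> G" by (rule normal_invI)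
    moreover have "Z \<subseteq> N" "Z \<noteq> {\<one>}" using z by (auto simp: Z_def)
    ultimately have "Z = N" using minimal by blast
    then have comm: "x \<otimes> y = y \<otimes> x" if "x \<in> N" "y \<in> N" for x y using that by (auto simp: Z_def)
    obtain H where H: "subgroup H G" "H \<inter> N = {\<one>}" "N <#> H = carrier G"
      using abelian_normal_complement[OF N fin comm cop] by metis
    have "H \<noteq> carrier G" using H(2) NG nontriv by blast
    then show thesis using that H by blast
  qed
qed

section \<open>Lifting supplements from a quotient group\<close>

lemma (in normal) preimage_subgroup:
  assumes "subgroup L (G Mod H)"
  shows "subgroup {x \<in> carrier G. H #> x \<in> L} G" "H \<subseteq> {x \<in> carrier G. H #> x \<in> L}"
proof -
  interpret Q: group "G Mod H" by (rule factorgroup_is_group)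
  interpret f: group_hom G "G Mod H" "\<lambda>x. H #> x"
    using r_coset_hom_Mod by (simp add: group_hom_def group_hom_axioms_def is_group Q.is_group)
  interpret L: subgroup L "G Mod H" by (rule assms)
  show "subgroup {x \<in> carrier G. H #> x \<in> L} G"
  proof (rule subgroupI)
    show "{x \<in> carrier G. H #> x \<in> L} \<noteq> {}"
      using L.one_closed subset rcos_const[OF is_group subgroup.one_closed[OF subgroup_axioms]] by force
    show "inv x \<in> {x \<in> carrier G. H #> x \<in> L}" if "x \<in> {x \<in> carrier G. H #> x \<in> L}" for x
      using that f.hom_inv[of x] L.m_inv_closed[of "H #> x"] by simp
    show "x \<otimes> y \<in> {x \<in> carrier G. H #> x \<in> L}"
      if xy: "x \<in> {x \<in> carrier G. H #> x \<in> L}" "y \<in> {x \<in> carrier G. H #> x \<in> L}" for x y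
    proof -
      have "(H #> x) \<otimes>\<^bsub>G Mod H\<^esub> (H #> y) \<in> L" using xy by (intro L.m_closed) auto
      then show ?thesis using xy rcos_sum[of x y] by auto
    qed
  qed auto
  show "H \<subseteq> {x \<in> carrier G. H #> x \<in> L}"
    using L.one_closed rcos_const[OF is_group] subset by auto
qed

lemma (in normal) preimage_normal:
  assumes "L \<lhd> (G Mod H)"
  shows "{x \<in> carrier G. H #> x \<in> L} \<lhd> G"
proof (rule normal_invI)
  interpret Q: group "G Mod H" by (rule factorgroup_is_group)
  interpret f: group_hom G "G Mod H" "\<lambda>x. H #> x"
    using r_coset_hom_Mod by (simp add: group_hom_def group_hom_axioms_def is_group Q.is_group)
  show "subgroup {x \<in> carrier G. H #> x \<in> L} G"
    using preimage_subgroup normal_imp_subgroup assms by blast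
  fix x y assume x: "x \<in> carrier G" and y: "y \<in> {x \<in> carrier G. H #> x \<in> L}"
  have "H #> (x \<otimes> y \<otimes> inv x) = (H #> x) \<otimes>\<^bsub>G Mod H\<^esub> (H #> y) \<otimes>\<^bsub>G Mod H\<^esub> inv\<^bsub>G Mod H\<^esub> (H #> x)"
    using x y f.hom_mult[of "x \<otimes> y" "inv x"] f.hom_mult[of x y] f.hom_inv[of x] by simp
  also have "\<dots> \<in> L" using normal.inv_op_closed2[OF assms f.hom_closed[OF x]] y by simp
  finally show "x \<otimes> y \<otimes> inv x \<in> {x \<in> carrier G. H #> x \<in> L}" using x y by simp
qed

text \<open>In \<open>G Mod N\<close> the image of \<open>K\<close> is a minimal normal subgroup,
  with order the number of cosets of \<open>N\<close> in \<open>K\<close> and the same index as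
  \<open>K\<close> in \<open>G\<close>. The preimage of a proper supplement there is a proper
  supplement of \<open>K\<close> containing \<open>N\<close>.\<close>

lemma (in group) chief_pair_coprime_supplement:
  assumes chief: "chief_pair G K N" and fin: "finite (carrier G)"
    and cop: "coprime (card (rcosets\<^bsub>G\<lparr>carrier := K\<rparr>\<^esub> N)) (card (rcosets K))"
  obtains H where "subgroup H G" "N \<subseteq> H" "H \<noteq> carrier G" "K <#> H = carrier G"
proof -
  have K: "K \<lhd> G" and N: "N \<lhd> G" and NK: "N \<subset> K"
    and max: "\<And>L. L \<lhd> G \<Longrightarrow> N \<subseteq> L \<Longrightarrow> L \<subseteq> K \<Longrightarrow> L = N \<or> L = K"
    using chief by (auto simp: chief_pair_def)
  interpret N: normal N G by (rule N)
  interpret K: normal K G by (rule K)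
  let ?Q = "G Mod N"
  interpret Q: group ?Q by (rule N.factorgroup_is_group)
  interpret f: group_hom G ?Q "\<lambda>x. N #> x"
    using N.r_coset_hom_Mod by (simp add: group_hom_def group_hom_axioms_def is_group Q.is_group)
  have surj: "(\<lambda>x. N #> x) ` carrier G = carrier ?Q" by (simp add: carrier_FactGroup)
  define K' where "K' = (\<lambda>x. N #> x) ` K"
  have K'_eq: "K' = rcosets\<^bsub>G\<lparr>carrier := K\<rparr>\<^esub> N" by (auto simp: K'_def RCOSETS_def)
  have K': "K' \<lhd> ?Q" unfolding K'_def by (rule K.surj_hom_normal_subgroup[OF f.group_hom_axioms surj])
  have finQ: "finite (carrier ?Q)" using fin by (simp add: carrier_FactGroup)
  have mem: "x \<in> K" if x: "x \<in> carrier G" "N #> x \<in> K'" for x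
  proof -
    obtain k where k: "k \<in> K" "N #> x = N #> k" using x(2) by (auto simp: K'_def)
    then have "x \<in> N #> k" using rcos_self[OF x(1) N.subgroup_axioms] by simp
    then show ?thesis using k(1) NK by (auto simp: r_coset_def)
  qed
  have cardN: "card N > 0" using fin N.subset by (metis N.one_closed card_gt_0_iff empty_iff finite_subset)
  have cardK': "card K' * card N = card K"
  proof -
    have "subgroup N (G\<lparr>carrier := K\<rparr>)"
      using subgroup_incl[OF N.subgroup_axioms K.subgroup_axioms] NK by auto
    then show ?thesis
      using group.lagrange[OF K.subgroup_is_group[OF is_group]] by (simp add: K'_eq Coset.order_def)
  qed
  have "card K > 0" using fin K.subset by (metis K.one_closed card_gt_0_iff empty_iff finite_subset)
  then have cK': "card K' > 0" using cardK' by (metis mult_0 not_gr_zero)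
  \<comment> \<open>Equality of the two indices, multiplied by \<open>card K\<close>: both sides are
    the order of \<open>G\<close>.\<close>
  have "card (rcosets\<^bsub>?Q\<^esub> K') * (card K' * card N) = card (rcosets K) * (card K' * card N)"
  proof -
    have "card (rcosets\<^bsub>?Q\<^esub> K') * card K' = card (rcosets N)"
      using Q.lagrange[OF normal_imp_subgroup[OF K']] by (simp add: Coset.order_def FactGroup_def)
    then have "card (rcosets\<^bsub>?Q\<^esub> K') * (card K' * card N) = Coset.order G"
      using lagrange[OF N.subgroup_axioms] by (simp add: mult.assoc[symmetric])
    then show ?thesis using lagrange[OF K.subgroup_axioms] cardK' by simp
  qed
  then have "card (rcosets\<^bsub>?Q\<^esub> K') = card (rcosets K)" using cardN cK' by simp
  then have cop': "coprime (card K') (card (rcosets\<^bsub>?Q\<^esub> K'))" using cop K'_eq by simp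
  have nontriv: "K' \<noteq> {\<one>\<^bsub>?Q\<^esub>}"
  proof
    assume "K' = {\<one>\<^bsub>?Q\<^esub>}"
    then have "card K = card N" using cardK' by simp
    then show False using NK fin K.subset by (metis card_subset_eq finite_subset psubset_imp_subset psubset_eq)
  qed
  have minimal: "L = {\<one>\<^bsub>?Q\<^esub>} \<or> L = K'" if L: "L \<lhd> ?Q" and LK: "L \<subseteq> K'" for L
  proof -
    \<comment> \<open>The full preimage of \<open>L\<close> lies between \<open>N\<close> and
      \<open>K\<close>, so the chief pair condition applies to it.\<close>
    let ?L = "{x \<in> carrier G. N #> x \<in> L}"
    have LQ: "L \<subseteq> carrier ?Q" using L by (simp add: normal_imp_subgroup subgroup.subset)
    have img: "L = (\<lambda>x. N #> x) ` ?L" using LQ by (auto simp: carrier_FactGroup)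
    have "?L \<lhd> G" "N \<subseteq> ?L"
      using N.preimage_normal[OF L] N.preimage_subgroup(2)[OF normal_imp_subgroup[OF L]] by auto
    moreover have "?L \<subseteq> K" using mem LK by auto
    ultimately have "?L = N \<or> ?L = K" by (rule max)
    then show ?thesis
    proof
      assume "?L = N"
      then have "L = (\<lambda>x. N #> x) ` N" using img by simp
      also have "\<dots> = (\<lambda>x. N) ` N" using N.rcos_const[OF is_group] by (intro image_cong) auto
      also have "\<dots> = {\<one>\<^bsub>?Q\<^esub>}" using image_constant[OF subgroup.one_closed[OF N.subgroup_axioms], of N] by simp
      finally show ?thesis by simp
    next
      assume "?L = K"
      then show ?thesis using img K'_def by simp
    qed
  qed
  obtain H' where H': "subgroup H' ?Q" "H' \<noteq> carrier ?Q" "K' <#>\<^bsub>?Q\<^esub> H' = carrier ?Q"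
    using Q.minimal_normal_coprime_supplement[OF K' finQ nontriv cop' minimal] by metis
  define H where "H = {x \<in> carrier G. N #> x \<in> H'}"
  have H: "subgroup H G" "N \<subseteq> H" unfolding H_def using N.preimage_subgroup[OF H'(1)] by auto
  have "H \<noteq> carrier G"
  proof
    assume "H = carrier G"
    then have "carrier ?Q \<subseteq> H'" by (auto simp: H_def carrier_FactGroup)
    then show False using H'(1,2) subgroup.subset by blast
  qed
  moreover have "K <#> H = carrier G"
  proof
    show "K <#> H \<subseteq> carrier G" using K.subset subgroup.subset[OF H(1)] by (rule setmult_subset_G)
    show "carrier G \<subseteq> K <#> H"
    proof
      fix g assume g: "g \<in> carrier G"
      then have "N #> g \<in> K' <#>\<^bsub>?Q\<^esub> H'" using H'(3) by (auto simp: carrier_FactGroup)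
      then obtain k h where k: "k \<in> K" and h: "h \<in> H'" "N #> g = (N #> k) \<otimes>\<^bsub>?Q\<^esub> h"
        unfolding set_mult_def[of ?Q] K'_def by blast
      have kG: "k \<in> carrier G" using k K.subset by auto
      have "h \<in> carrier ?Q" using h H' subgroup.subset by blast
      then have "h = inv\<^bsub>?Q\<^esub> (N #> k) \<otimes>\<^bsub>?Q\<^esub> (N #> g)"
        unfolding h(2) using f.hom_closed[OF kG] Q.inv_closed by (simp add: Q.m_assoc[symmetric] del: mult_FactGroup one_FactGroup)
      also have "\<dots> = N #> (inv k \<otimes> g)" using f.hom_inv[OF kG] f.hom_mult[of "inv k" g] kG g by simp
      finally have "inv k \<otimes> g \<in> H" using h kG g by (simp add: H_def)
      moreover have "g = k \<otimes> (inv k \<otimes> g)" using kG g by (simp add: m_assoc[symmetric])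
      ultimately show "g \<in> K <#> H" using k unfolding set_mult_def by blast
    qed
  qed
  ultimately show thesis using that H by blast
qed

section \<open>Maximal subgroups and index divisibility\<close>

lemma (in group) exists_maximal_subgroup_containing:
  assumes fin: "finite (carrier G)" and H: "subgroup H G" "H \<noteq> carrier G"
  obtains M where "maximal_subgroup M G" "H \<subseteq> M"
proof -
  define S where "S = {M. subgroup M G \<and> M \<noteq> carrier G \<and> H \<subseteq> M}"
  have "S \<subseteq> Pow (carrier G)" by (auto simp: S_def dest: subgroup.subset)
  then have "finite S" using fin by (metis finite_Pow_iff finite_subset)
  moreover have "S \<noteq> {}" using H by (auto simp: S_def)
  ultimately obtain M where M: "M \<in> S" "\<And>L. L \<in> S \<Longrightarrow> M \<subseteq> L \<Longrightarrow> M = L"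
    using finite_has_maximal[of S] by blast
  then have "maximal_subgroup M G" unfolding maximal_subgroup_def S_def by blast
  then show thesis using that M by (auto simp: S_def)
qed

text \<open>As \<open>L\<close> and \<open>K\<close> have product \<open>G\<close>, the index of
  \<open>L\<close> in \<open>G\<close> equals that of \<open>L \<inter> K\<close> in
  \<open>K\<close>; the latter divides the index of \<open>N\<close> in \<open>K\<close> because
  \<open>N\<close> is contained in \<open>L \<inter> K\<close>.\<close>

lemma (in group) index_dvd_section_order:
  assumes fin: "finite (carrier G)" and L: "subgroup L G" and K: "subgroup K G" and N: "subgroup N G"
    and NK: "N \<subseteq> K" and NL: "N \<subseteq> L" and LK: "L <#> K = carrier G"
  shows "card (rcosets L) dvd card (rcosets\<^bsub>G\<lparr>carrier := K\<rparr>\<^esub> N)"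
proof -
  let ?K = "G\<lparr>carrier := K\<rparr>" and ?I = "L \<inter> K"
  interpret KK: group ?K by (rule subgroup.subgroup_is_group[OF K is_group])
  have I: "subgroup ?I G" by (rule subgroups_Inter_pair[OF L K])
  have LG: "L \<subseteq> carrier G" and KG: "K \<subseteq> carrier G" using L K by (simp_all add: subgroup.subset)
  have coset: "L <#> (?I #> k) = L #> k" if "k \<in> K" for k
  proof -
    have "L <#> ?I = L"
    proof
      show "L <#> ?I \<subseteq> L" using L by (auto simp: set_mult_def subgroup.m_closed)
      show "L \<subseteq> L <#> ?I"
      proof
        fix x assume "x \<in> L"
        then have "x \<otimes> \<one> \<in> L <#> ?I" using subgroup.one_closed[OF I] unfolding set_mult_def by blast
        then show "x \<in> L <#> ?I" using \<open>x \<in> L\<close> LG by auto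
      qed
    qed
    then show ?thesis using setmult_rcos_assoc[of L ?I k] LG KG that by auto
  qed
  have rI: "rcosets\<^bsub>?K\<^esub> ?I = {?I #> k | k. k \<in> K}" by (auto simp: RCOSETS_def)
  \<comment> \<open>Enlarging a coset of \<open>L \<inter> K\<close> in \<open>K\<close> to the
    coset of \<open>L\<close> containing it is the bijection behind the equality of indices.\<close>
  have "bij_betw (\<lambda>C. L <#> C) (rcosets\<^bsub>?K\<^esub> ?I) (rcosets L)"
    unfolding bij_betw_def
  proof
    show "inj_on (\<lambda>C. L <#> C) (rcosets\<^bsub>?K\<^esub> ?I)"
    proof (rule inj_onI)
      fix C D assume "C \<in> rcosets\<^bsub>?K\<^esub> ?I" "D \<in> rcosets\<^bsub>?K\<^esub> ?I" and eq: "L <#> C = L <#> D"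
      then obtain k l where kl: "k \<in> K" "l \<in> K" "C = ?I #> k" "D = ?I #> l" unfolding rI by blast
      have klG: "k \<in> carrier G" "l \<in> carrier G" using kl KG by auto
      have "L #> k = L #> l" using eq kl coset by simp
      then have "k \<in> L #> l" using rcos_self[OF klG(1) L] by simp
      then have "k \<otimes> inv l \<in> L" using subgroup.rcos_module[OF L is_group klG(2,1)] by simp
      moreover have "k \<otimes> inv l \<in> K" using kl K by (simp add: subgroup.m_closed subgroup.m_inv_closed)
      ultimately have "k \<in> ?I #> l" using subgroup.rcos_module[OF I is_group klG(2,1)] by simp
      then show "C = D" using repr_independence[OF _ klG(2) I] kl by simp
    qed
    show "(\<lambda>C. L <#> C) ` (rcosets\<^bsub>?K\<^esub> ?I) = rcosets L"
    proof
      show "(\<lambda>C. L <#> C) ` (rcosets\<^bsub>?K\<^esub> ?I) \<subseteq> rcosets L"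
        using coset KG LG by (auto simp: rI intro!: rcosetsI)
      show "rcosets L \<subseteq> (\<lambda>C. L <#> C) ` (rcosets\<^bsub>?K\<^esub> ?I)"
      proof
        fix C assume "C \<in> rcosets L"
        then obtain g where g: "g \<in> carrier G" "C = L #> g" by (auto simp: RCOSETS_def)
        then obtain l k where lk: "l \<in> L" "k \<in> K" "g = l \<otimes> k"
          using LK unfolding set_mult_def by blast
        then have "g \<in> L #> k" by (auto simp: r_coset_def)
        then have "C = L #> k" using g repr_independence[OF _ _ L, of g k] lk KG by auto
        then show "C \<in> (\<lambda>C. L <#> C) ` (rcosets\<^bsub>?K\<^esub> ?I)" using coset[OF lk(2)] lk(2) by (auto simp: rI)
      qed
    qed
  qed
  then have card_eq: "card (rcosets L) = card (rcosets\<^bsub>?K\<^esub> ?I)" by (simp add: bij_betw_same_card)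
  have "subgroup ?I ?K" by (rule subgroup_incl[OF I K]) auto
  then have 1: "card (rcosets\<^bsub>?K\<^esub> ?I) * card ?I = card K"
    using KK.lagrange by (simp add: Coset.order_def)
  have 2: "card (rcosets\<^bsub>?K\<^esub> N) * card N = card K"
    using KK.lagrange[OF subgroup_incl[OF N K NK]] by (simp add: Coset.order_def)
  have "card N dvd card ?I"
  proof -
    have "subgroup N (G\<lparr>carrier := ?I\<rparr>)" using subgroup_incl[OF N I] NK NL by auto
    from group.lagrange[OF subgroup.subgroup_is_group[OF I is_group] this]
    show ?thesis by (simp add: Coset.order_def flip: dvd_def) (metis dvd_triv_right)
  qed
  then obtain j where "card ?I = card N * j" by blast
  then have "card (rcosets\<^bsub>?K\<^esub> N) * card N = (card (rcosets L) * j) * card N"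
    using 1 2 card_eq by (simp add: ac_simps)
  moreover have "card N > 0"
    using finite_subset[OF subgroup.subset[OF N] fin] subgroup.one_closed[OF N] by (auto simp: card_gt_0_iff)
  ultimately show ?thesis by simp
qed

section \<open>Characters lying over maximal subgroups\<close>

lemma pi_number_mult: "pi_number \<pi> (a * b) \<longleftrightarrow> pi_number \<pi> a \<and> pi_number \<pi> b"
  by (auto simp: pi_number_def prime_dvd_mult_iff)

lemma pi_number_dvd: "pi_number \<pi> b \<Longrightarrow> a dvd b \<Longrightarrow> pi_number \<pi> a"
  by (metis dvdE pi_number_mult)

lemma pi_number_compl_coprime:
  assumes "pi_number \<pi> a" "pi_number (prime_compl \<pi>) b"
  shows "coprime a b"
proof (rule ccontr)
  assume "\<not> coprime a b"
  then have "gcd a b \<noteq> 1" by (simp add: coprime_iff_gcd_eq_1)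
  then obtain p where "Factorial_Ring.prime p" "p dvd gcd a b" using prime_factor_nat by blast
  then show False using assms by (auto simp: pi_number_def prime_compl_def)
qed

text \<open>The product is a subgroup because \<open>N\<close> is normal, and it contains
  \<open>L\<close> strictly because it contains \<open>N\<close>.\<close>

lemma (in group) maximal_subgroup_normal_product:
  assumes L: "maximal_subgroup L G" and N: "N \<lhd> G" and NL: "\<not> N \<subseteq> L"
  shows "N <#> L = carrier G"
proof -
  have Lsub: "subgroup L G" using L by (simp add: maximal_subgroup_def)
  have NG: "N \<subseteq> carrier G" using N by (simp add: normal_imp_subgroup subgroup.subset)
  have LG: "L \<subseteq> carrier G" by (rule subgroup.subset[OF Lsub])
  have sub: "subgroup (N <#> L) G" by (rule mult_norm_subgroup[OF N Lsub])
  have "L \<subseteq> N <#> L"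
  proof
    fix x assume x: "x \<in> L"
    then have "\<one> \<otimes> x \<in> N <#> L"
      using subgroup.one_closed[OF normal_imp_subgroup[OF N]] unfolding set_mult_def by blast
    then show "x \<in> N <#> L" using x LG by auto
  qed
  moreover have "N \<subseteq> N <#> L"
  proof
    fix x assume x: "x \<in> N"
    then have "x \<otimes> \<one> \<in> N <#> L" using subgroup.one_closed[OF Lsub] unfolding set_mult_def by blast
    then show "x \<in> N <#> L" using x NG by auto
  qed
  ultimately show ?thesis using sub L NL unfolding maximal_subgroup_def by blast
qed

text \<open>\<open>K\<close> is a normal subgroup of least order among those of \<pi>-index, and
  \<open>N\<close> is maximal among the normal subgroups of \<open>G\<close> properly inside
  \<open>K\<close>. Were the factor a \<pi>-group, \<open>N\<close> would be a smaller normal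
  subgroup of \<pi>-index; separability then makes it a \<pi>'-group.\<close>

lemma (in group) exists_coprime_chief_pair:
  assumes sep: "pi_separable \<pi> G" and npi: "\<not> pi_group \<pi> G"
  obtains K N where "chief_pair G K N" "pi_number \<pi> (card (rcosets K))"
    "pi_number (prime_compl \<pi>) (card (rcosets\<^bsub>G\<lparr>carrier := K\<rparr>\<^esub> N))"
proof -
  have fin: "finite (carrier G)" using sep by (simp add: pi_separable_def)
  define P where "P L \<longleftrightarrow> L \<lhd> G \<and> pi_number \<pi> (card (rcosets L))" for L
  have "card (rcosets (carrier G)) = 1"
    using lagrange[OF subgroup_self] fin by (auto simp: Coset.order_def card_gt_0_iff)
  then have "P (carrier G)" using normal_self by (simp add: P_def pi_number_def)
  then obtain K where K: "P K" "\<And>L. P L \<Longrightarrow> card K \<le> card L"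
    using ex_has_least_nat[of P "carrier G" card] by blast
  have Kn: "K \<lhd> G" using K by (simp add: P_def)
  have Ksub: "subgroup K G" by (rule normal_imp_subgroup[OF Kn])
  have finK: "finite K" using subgroup.subset[OF Ksub] fin finite_subset by blast
  \<comment> \<open>If \<open>K\<close> were trivial, its index \<open>|G|\<close> would be a
    \<pi>-number and \<open>G\<close> a \<pi>-group.\<close>
  have "K \<noteq> {\<one>}"
  proof
    assume "K = {\<one>}"
    then have "pi_number \<pi> (Coset.order G)" using K(1) card_rcosets_triv[OF fin] by (simp add: P_def)
    then show False using npi fin is_group by (simp add: pi_group_def)
  qed
  define S where "S = {L. L \<lhd> G \<and> L \<subset> K}"
  have "S \<subseteq> Pow K" by (auto simp: S_def)
  then have "finite S" using finK by (metis finite_Pow_iff finite_subset)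
  moreover have "{\<one>} \<in> S"
    using \<open>K \<noteq> {\<one>}\<close> one_is_normal subgroup.one_closed[OF Ksub] by (auto simp: S_def)
  ultimately obtain N where N: "N \<in> S" "\<And>L. L \<in> S \<Longrightarrow> N \<subseteq> L \<Longrightarrow> N = L"
    using finite_has_maximal[of S] by blast
  then have chief: "chief_pair G K N" unfolding chief_pair_def S_def using Kn by blast
  have Nsub: "subgroup N G" and NK: "N \<subset> K" using N(1) by (auto simp: S_def normal_imp_subgroup)
  let ?K = "G\<lparr>carrier := K\<rparr>"
  have ord: "Coset.order (?K Mod N) = card (rcosets\<^bsub>?K\<^esub> N)"
    by (simp add: Coset.order_def FactGroup_def)
  have "\<not> pi_group \<pi> (?K Mod N)"
  proof
    assume "pi_group \<pi> (?K Mod N)"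
    then have "pi_number \<pi> (card (rcosets\<^bsub>?K\<^esub> N))" using ord by (simp add: pi_group_def)
    moreover have "card (rcosets\<^bsub>?K\<^esub> N) * card N = card K"
      using group.lagrange[OF subgroup.subgroup_is_group[OF Ksub is_group] subgroup_incl[OF Nsub Ksub]] NK
      by (auto simp: Coset.order_def)
    then have "card (rcosets N) * card N = card (rcosets K) * card (rcosets\<^bsub>?K\<^esub> N) * card N"
      using lagrange[OF Nsub] lagrange[OF Ksub] by (simp add: mult.assoc)
    moreover have "card N > 0"
      using finite_subset[OF _ finK, of N] NK subgroup.one_closed[OF Nsub] by (auto simp: card_gt_0_iff)
    ultimately have "pi_number \<pi> (card (rcosets N))"
      using K(1) by (simp add: P_def pi_number_mult)
    then have "P N" using N(1) by (simp add: P_def S_def)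
    then have "card K \<le> card N" by (rule K(2))
    then show False using psubset_card_mono[OF finK NK] by simp
  qed
  then have "pi_group (prime_compl \<pi>) (?K Mod N)"
    using sep chief unfolding pi_separable_def by blast
  then have "pi_number (prime_compl \<pi>) (card (rcosets\<^bsub>?K\<^esub> N))" using ord by (simp add: pi_group_def)
  then show thesis using that chief K(1) by (simp add: P_def)
qed

lemma (in group) exists_P_not_P_pi:
  assumes sep: "pi_separable \<pi> G" and npi: "\<not> pi_group \<pi> G"
  shows "\<exists>\<chi>. \<chi> \<in> Irr_P G \<and> \<chi> \<notin> Irr_P_pi \<pi> G"
proof -
  have fin: "finite (carrier G)" using sep by (simp add: pi_separable_def)
  obtain K N where chief: "chief_pair G K N" and piK: "pi_number \<pi> (card (rcosets K))"
    and piN: "pi_number (prime_compl \<pi>) (card (rcosets\<^bsub>G\<lparr>carrier := K\<rparr>\<^esub> N))"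
    using exists_coprime_chief_pair[OF sep npi] by metis
  have K: "K \<lhd> G" and N: "N \<lhd> G" and NK: "N \<subseteq> K" using chief by (auto simp: chief_pair_def)
  have KG: "K \<subseteq> carrier G" and NG: "N \<subseteq> carrier G"
    using K N by (simp_all add: normal_imp_subgroup subgroup.subset)
  obtain H where H: "subgroup H G" "N \<subseteq> H" "H \<noteq> carrier G" "K <#> H = carrier G"
    using chief_pair_coprime_supplement[OF chief fin] pi_number_compl_coprime[OF piK piN]
    by (metis coprime_commute)
  obtain M where M: "maximal_subgroup M G" "H \<subseteq> M"
    using exists_maximal_subgroup_containing[OF fin H(1,3)] by metis
  have Msub: "subgroup M G" and MG: "M \<noteq> carrier G" using M by (auto simp: maximal_subgroup_def)
  obtain n0 \<rho>0 where "matrix_rep G n0 \<rho>0" "mean_trace M \<rho>0 \<noteq> mean_trace (carrier G) \<rho>0"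
    using mean_trace_gap_regular[OF fin Msub MG] by metis
  then obtain n \<rho> where irr: "irreducible_rep G n \<rho>"
    and gap: "mean_trace M \<rho> \<noteq> mean_trace (carrier G) \<rho>"
    using exists_irreducible_mean_trace_neq[OF _ subgroup.subset[OF Msub] subset_refl] by metis
  have rep: "matrix_rep G n \<rho>" using irr by (simp add: irreducible_rep_def)
  note no_inv = irreducible_rep_no_invariant_vector[OF irr fin Msub gap]
  \<comment> \<open>If the mean over \<open>M\<close> were 0, the gap would make the mean over
    \<open>G\<close> nonzero and so yield a nonzero vector fixed by \<open>G\<close>.\<close>
  have "mean_trace M \<rho> \<noteq> 0"
  proof
    assume "mean_trace M \<rho> = 0"
    then have "mean_trace (carrier G) \<rho> \<noteq> 0" using gap by simp
    then show False using subgroup_invariant_vector[OF rep subgroup_self] no_inv by metis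
  qed
  then have "rep_character G \<rho> \<in> Irr_P G"
    using irr M(1) char_inner_induced_principal[OF rep fin Msub] unfolding Irr_P_def Irr_def by auto
  moreover have "rep_character G \<rho> \<notin> Irr_P_pi \<pi> G"
  proof
    assume "rep_character G \<rho> \<in> Irr_P_pi \<pi> G"
    then obtain L where L: "maximal_subgroup L G" and piL: "pi_number \<pi> (card (rcosets L))"
      and "char_inner G (rep_character G \<rho>) (induced_char G L (principal_char L)) \<noteq> 0"
      unfolding Irr_P_pi_def subgroup_index_def by blast
    then have Lsub: "subgroup L G" and nz: "mean_trace L \<rho> \<noteq> 0"
      using char_inner_induced_principal[OF rep fin] by (auto simp: maximal_subgroup_def)
    obtain u where u: "u \<in> carrier_vec n" "u \<noteq> 0\<^sub>v n" "\<And>g. g \<in> M \<Longrightarrow> \<rho> g *\<^sub>v u = u"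
      using subgroup_invariant_vector[OF rep Msub \<open>mean_trace M \<rho> \<noteq> 0\<close>] by metis
    obtain v where v: "v \<in> carrier_vec n" "v \<noteq> 0\<^sub>v n" "\<And>g. g \<in> L \<Longrightarrow> \<rho> g *\<^sub>v v = v"
      using subgroup_invariant_vector[OF rep Lsub nz] by metis
    \<comment> \<open>A nonzero vector fixed by two sets with product \<open>G\<close> is fixed by
      \<open>G\<close>, which the gap excludes. Both cases below end here, with \<open>u\<close> for
      \<open>K\<close> and \<open>H\<close>, and with \<open>v\<close> for \<open>N\<close> and
      \<open>L\<close>.\<close>
    have product: False
      if w: "w \<in> carrier_vec n" "w \<noteq> 0\<^sub>v n" and "A \<subseteq> carrier G" "B \<subseteq> carrier G"
        and AB: "A <#> B = carrier G"
        and fixed: "\<And>g. g \<in> A \<Longrightarrow> \<rho> g *\<^sub>v w = w" "\<And>g. g \<in> B \<Longrightarrow> \<rho> g *\<^sub>v w = w" for w A B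
    proof -
      have "\<rho> g *\<^sub>v w = w" if g: "g \<in> carrier G" for g
      proof -
        obtain a b where ab: "a \<in> A" "b \<in> B" "g = a \<otimes> b"
          using g AB unfolding set_mult_def by blast
        then have "a \<in> carrier G" "b \<in> carrier G"
          using \<open>A \<subseteq> carrier G\<close> \<open>B \<subseteq> carrier G\<close> by auto
        then show ?thesis using matrix_rep_mult_vec[OF rep _ _ w(1), of a b] fixed ab by simp
      qed
      then show False using no_inv w by blast
    qed
    show False
    proof (cases "N \<subseteq> L")
      case True
      have "K \<subseteq> L"
      proof (rule ccontr)
        assume "\<not> K \<subseteq> L"
        then have "L <#> K = carrier G"
          using maximal_subgroup_normal_product[OF L K] commut_normal[OF Lsub K] by simp
        then have "card (rcosets L) dvd card (rcosets\<^bsub>G\<lparr>carrier := K\<rparr>\<^esub> N)"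
          using index_dvd_section_order[OF fin Lsub normal_imp_subgroup[OF K] normal_imp_subgroup[OF N] NK True]
          by simp
        \<comment> \<open>The index of \<open>L\<close> is a \<pi>-number and divides a
          \<pi>'-number, so it is coprime to itself and hence 1, contradicting that \<open>L\<close>
          is proper.\<close>
        then have "coprime (card (rcosets L)) (card (rcosets L))"
          using pi_number_compl_coprime[OF piL] pi_number_dvd[OF piN] by blast
        then have "card (rcosets L) = 1" by simp
        then have "card L = card (carrier G)" using lagrange[OF Lsub] by (simp add: Coset.order_def)
        then have "L = carrier G" using card_subset_eq[OF fin subgroup.subset[OF Lsub]] by simp
        then show False using L by (simp add: maximal_subgroup_def)
      qed
      \<comment> \<open>\<open>K\<close> fixes \<open>v \<noteq> 0\<close> because
        \<open>K \<subseteq> L\<close>; being normal, it acts trivially and so fixes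
        \<open>u\<close> too.\<close>
      then have "\<rho> g *\<^sub>v u = u" if "g \<in> K" for g
        using irreducible_rep_normal_invariant[OF irr K v(1,2) _ u(1) that] v(3) by blast
      then show False
        using product[OF u(1,2) KG subgroup.subset[OF H(1)] H(4)] u(3) M(2) by blast
    next
      case False
      have "N \<subseteq> M" using H M by blast
      \<comment> \<open>The roles are exchanged: \<open>N \<subseteq> M\<close> fixes
        \<open>u \<noteq> 0\<close>, so \<open>N\<close> acts trivially and fixes
        \<open>v\<close>.\<close>
      then have "\<rho> g *\<^sub>v v = v" if "g \<in> N" for g
        using irreducible_rep_normal_invariant[OF irr N u(1,2) _ v(1) that] u(3) by blast
      then show False
        using product[OF v(1,2) NG subgroup.subset[OF Lsub] maximal_subgroup_normal_product[OF L N False]]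
          v(3) by blast
    qed
  qed
  ultimately show ?thesis by blast
qed

text \<open>By Lagrange every index divides the group order, so the index condition holds for all
  maximal subgroups.\<close>

lemma (in group) pi_group_Irr_P_pi_eq:
  assumes "pi_group \<pi> G"
  shows "Irr_P_pi \<pi> G = Irr_P G"
proof -
  have "pi_number \<pi> (subgroup_index G M)" if "maximal_subgroup M G" for M
    using assms lagrange[of M] that pi_number_dvd[of \<pi> "Coset.order G" "subgroup_index G M"]
    unfolding pi_group_def subgroup_index_def maximal_subgroup_def by (metis dvd_triv_left)
  then show ?thesis unfolding Irr_P_def Irr_P_pi_def by blast
qed

theorem theorem4:
  fixes G :: "('a, 'b) monoid_scheme" and \<pi> :: "nat set"
  assumes "\<forall>p\<in>\<pi>. Factorial_Ring.prime p"
    and "group G" and "finite (carrier G)"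
    and "pi_separable \<pi> G"
  shows "Irr_P_pi \<pi> G = Irr_P G \<longleftrightarrow> pi_group \<pi> G"
  using group.exists_P_not_P_pi[OF assms(2,4)] group.pi_group_Irr_P_pi_eq[OF assms(2)] by blast

end
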